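(* Let $M$ be a finite Markov chain with $m$ states and $\varphi$ a pLTL$_\Diamond$ formula. Then $V_{=1}(\varphi)\neq\emptyset$ if and only if $\bar v\in V_{=1}(\varphi)$, where $\bar v(x)=m\cdot|\varphi|\cdot 2^{|\varphi|}$ for every variable $x$.
   Context: pLTL$_\Diamond$ formulas (in negation normal form): $\varphi ::= a\mid\neg a\mid\varphi\wedge\varphi\mid\varphi\vee\varphi\mid X\varphi\mid\varphi\,U\,\varphi\mid\varphi\,R\,\varphi\mid\Box\varphi\mid\Diamond_{\le x}\varphi\mid\Diamond_{\le c}\varphi\mid\Box_{\le c}\varphi$ with $a$ an atomic proposition, $x$ a variable, $c\in\mathbb{N}$; $|\varphi|$ is the length of $\varphi$. A valuation $v$ assigns a natural number to each variable. Semantics: usual LTL semantics ($R$ is release), $(w,i,v)\models\Diamond_{\le x}\psi$ iff $(w,j,v)\models\psi$ for some $i\le j\le i+v(x)$, $\Diamond_{\le c}$ likewise with constant $c$, and $(w,i,v)\models\Box_{\le c}\psi$ iff $(w,j,v)\models\psi$ for all $i\le j\le i+c$. For a finite Markov chain $M=(S,\mathbf P,s_0,L)$, $\Pr(M\models v(\varphi))$ is the probability of the set of paths from $s_0$ whose trace satisfies $\varphi$ under $v$, and $V_{=1}(\varphi)=\{v\mid\Pr(M\models v(\varphi))=1\}$. *)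

theory Defs
  imports "HOL-Probability.Probability"
begin

datatype ('a, 'x) pltl =
    Prop 'a
  | NegProp 'a
  | And "('a, 'x) pltl" "('a, 'x) pltl"
  | Or "('a, 'x) pltl" "('a, 'x) pltl"
  | Next "('a, 'x) pltl"
  | Until "('a, 'x) pltl" "('a, 'x) pltl"
  | Release "('a, 'x) pltl" "('a, 'x) pltl"
  | Always "('a, 'x) pltl"
  | EvVar 'x "('a, 'x) pltl"
  | EvConst nat "('a, 'x) pltl"
  | AlwConst nat "('a, 'x) pltl"

text \<open>
  The length of a formula is its number of symbols, where the constant bounds are written in
  unary: a bounded operator with constant \<open>c\<close> contributes \<open>1 + c\<close>, like the \<open>c\<close> nested \<open>Next\<close>
  operators it abbreviates. Variable bounds are part of their operator symbol.

  The unary convention matters. If \<open>c\<close> contributed nothing to the length, then for a fair coin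
  with outcomes \<open>a\<close> and \<open>not a\<close> the formula
  \<open>Or (EvVar x (Prop a)) (AlwConst c (NegProp a))\<close> would hold almost surely exactly for the
  valuations with \<open>v x \<ge> c\<close>, so that no bound depending only on the number of states and the
  length could suffice.
\<close>

primrec len :: "('a, 'x) pltl \<Rightarrow> nat" where
  "len (Prop a) = 1"
| "len (NegProp a) = 2"
| "len (And \<phi> \<psi>) = 1 + len \<phi> + len \<psi>"
| "len (Or \<phi> \<psi>) = 1 + len \<phi> + len \<psi>"
| "len (Next \<phi>) = 1 + len \<phi>"
| "len (Until \<phi> \<psi>) = 1 + len \<phi> + len \<psi>"
| "len (Release \<phi> \<psi>) = 1 + len \<phi> + len \<psi>"
| "len (Always \<phi>) = 1 + len \<phi>"
| "len (EvVar x \<phi>) = 1 + len \<phi>"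
| "len (EvConst c \<phi>) = 1 + c + len \<phi>"
| "len (AlwConst c \<phi>) = 1 + c + len \<phi>"

primrec sat :: "(nat \<Rightarrow> 'a set) \<Rightarrow> nat \<Rightarrow> ('x \<Rightarrow> nat) \<Rightarrow> ('a, 'x) pltl \<Rightarrow> bool" where
  "sat w i v (Prop a) \<longleftrightarrow> a \<in> w i"
| "sat w i v (NegProp a) \<longleftrightarrow> a \<notin> w i"
| "sat w i v (And \<phi> \<psi>) \<longleftrightarrow> sat w i v \<phi> \<and> sat w i v \<psi>"
| "sat w i v (Or \<phi> \<psi>) \<longleftrightarrow> sat w i v \<phi> \<or> sat w i v \<psi>"
| "sat w i v (Next \<phi>) \<longleftrightarrow> sat w (Suc i) v \<phi>"
| "sat w i v (Until \<phi> \<psi>) \<longleftrightarrow> (\<exists>j\<ge>i. sat w j v \<psi> \<and> (\<forall>k. i \<le> k \<and> k < j \<longrightarrow> sat w k v \<phi>))"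
| "sat w i v (Release \<phi> \<psi>) \<longleftrightarrow> (\<forall>j\<ge>i. sat w j v \<psi> \<or> (\<exists>k. i \<le> k \<and> k < j \<and> sat w k v \<phi>))"
| "sat w i v (Always \<phi>) \<longleftrightarrow> (\<forall>j\<ge>i. sat w j v \<phi>)"
| "sat w i v (EvVar x \<phi>) \<longleftrightarrow> (\<exists>j. i \<le> j \<and> j \<le> i + v x \<and> sat w j v \<phi>)"
| "sat w i v (EvConst c \<phi>) \<longleftrightarrow> (\<exists>j. i \<le> j \<and> j \<le> i + c \<and> sat w j v \<phi>)"
| "sat w i v (AlwConst c \<phi>) \<longleftrightarrow> (\<forall>j. i \<le> j \<and> j \<le> i + c \<longrightarrow> sat w j v \<phi>)"

text \<open>
  The states are the elements of the type \<open>'s\<close>, and the entry of the stochastic matrix at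
  \<open>(s, t)\<close> is \<open>pmf (transition M s) t\<close>.
\<close>

record ('s, 'a) markov_chain =
  transition :: "'s \<Rightarrow> 's pmf"
  initial :: 's
  label :: "'s \<Rightarrow> 'a set"

definition chain_step :: "('s \<Rightarrow> 's pmf) \<Rightarrow> 's \<Rightarrow> nat \<Rightarrow> (nat \<Rightarrow> 's) \<Rightarrow> 's measure" where
  "chain_step K s0 n \<omega> =
    measure_pmf (if n = 0 then return_pmf s0 else K (\<omega> (n - 1)))"

global_interpretation chain: Ionescu_Tulcea "chain_step K s0" "\<lambda>_. count_space UNIV"
  for K :: "'s \<Rightarrow> 's pmf" and s0 :: 's
proof (rule Ionescu_Tulcea.intro)
  fix n :: nat
  show "chain_step K s0 n \<in> measurable (PiM {0..<n} (\<lambda>_. count_space UNIV))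
      (subprob_algebra (count_space UNIV))"
  proof (cases n)
    case 0
    then show ?thesis
      by (simp add: chain_step_def[abs_def] measure_pmf_in_subprob_algebra)
  next
    case (Suc k)
    have "(\<lambda>\<omega>. \<omega> k) \<in> measurable (PiM {0..<n} (\<lambda>_. count_space UNIV))
        (count_space (UNIV :: 's set))"
      using Suc by (intro measurable_component_singleton) auto
    moreover have "(\<lambda>s. measure_pmf (K s)) \<in> measurable (count_space UNIV)
        (subprob_algebra (count_space UNIV))"
      by (simp add: measure_pmf_in_subprob_algebra)
    ultimately have "(\<lambda>\<omega>. measure_pmf (K (\<omega> k))) \<in>
        measurable (PiM {0..<n} (\<lambda>_. count_space UNIV)) (subprob_algebra (count_space UNIV))"
      by (rule measurable_compose)
    then show ?thesis
      using Suc by (simp add: chain_step_def[abs_def])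
  qed
next
  fix n :: nat and \<omega> :: "nat \<Rightarrow> 's"
  assume "\<omega> \<in> space (PiM {0..<n} (\<lambda>_. count_space UNIV))"
  show "prob_space (chain_step K s0 n \<omega>)"
    by (simp add: chain_step_def prob_space_measure_pmf)
qed

definition path_measure :: "('s, 'a) markov_chain \<Rightarrow> (nat \<Rightarrow> 's) measure" where
  "path_measure M = chain.PF.lim (transition M) (initial M)"

lemma sets_path_measure [measurable_cong]:
  "sets (path_measure M) = sets (PiM UNIV (\<lambda>_. count_space UNIV))"
  by (simp add: path_measure_def chain.PF.sets_lim)

lemma space_path_measure [simp]: "space (path_measure M) = UNIV"
  by (simp add: path_measure_def chain.PF.space_lim space_PiM)

lemma prob_space_path_measure: "prob_space (path_measure M)"
proof (rule prob_space_distrD)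
  show "(\<lambda>\<omega>. restrict \<omega> {}) \<in>
      measurable (path_measure M) (PiM {} (\<lambda>_. count_space UNIV))"
    unfolding measurable_cong_sets[OF sets_path_measure refl]
    by (rule measurable_restrict_subset) simp
  show "prob_space (distr (path_measure M) (PiM {} (\<lambda>_. count_space UNIV))
      (\<lambda>\<omega>. restrict \<omega> {}))"
    unfolding path_measure_def using chain.distr_lim[of "{}" "transition M" "initial M"] chain.PF.prob_space_P[of "{}" "transition M" "initial M"]
    by simp
qed

lemma emeasure_path_prefix:
  "emeasure (chain.C K s0 0 n (\<lambda>_. undefined)) {restrict \<pi> {0..<n}} =
    (\<Prod>i<n. emeasure (chain_step K s0 i \<pi>) {\<pi> i})"
proof (induction n)
  case 0
  show ?case
    by (simp add: PiM_empty restrict_def)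
next
  case (Suc n)
  let ?P = "\<lambda>n. PiM {0..<n} (\<lambda>_. count_space (UNIV :: 'a set))"
  let ?\<pi> = "\<lambda>n. restrict \<pi> {0..<n}"
  let ?C = "chain.C K s0 0 n (\<lambda>_. undefined)"
  have u: "(\<lambda>_. undefined) \<in> space (?P 0)"
    by (simp add: space_PiM PiE_iff extensional_def)
  have singleton: "{?\<pi> k} \<in> sets (?P k)" for k
  proof -
    have "{?\<pi> k} = PiE {0..<k} (\<lambda>i. {\<pi> i})"
      by (auto simp: PiE_singleton[symmetric] PiE_iff fun_eq_iff extensional_def)
    then show ?thesis
      by (simp add: sets_PiM_I_finite)
  qed
  have spC: "space ?C = space (?P n)"
    using chain.space_C[OF u, of K s0 n] by simp
  have "emeasure (chain.C K s0 0 (Suc n) (\<lambda>_. undefined)) {?\<pi> (Suc n)} =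
      (\<integral>\<^sup>+\<omega>. emeasure (chain.eP K s0 n \<omega>) {?\<pi> (Suc n)} \<partial>?C)"
    unfolding chain.C.simps
  proof (subst emeasure_bind)
    show "space ?C \<noteq> {}"
      using spC by (simp add: space_PiM PiE_eq_empty_iff)
    show "chain.eP K s0 (0 + n) \<in> measurable ?C (subprob_algebra (?P (Suc n)))"
      using chain.measurable_eP[of K s0 n]
        measurable_cong_sets[OF chain.sets_C[OF u, of K s0 n, unfolded add_0_left] refl]
      by (metis add_0_left)
    show "{?\<pi> (Suc n)} \<in> sets (?P (Suc n))"
      by (rule singleton)
  qed simp
  also have "\<dots> = (\<integral>\<^sup>+\<omega>. emeasure (chain_step K s0 n \<pi>) {\<pi> n} * indicator {?\<pi> n} \<omega> \<partial>?C)"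
  proof (rule nn_integral_cong)
    fix \<omega>
    assume "\<omega> \<in> space ?C"
    then have \<omega>: "\<omega> \<in> space (?P n)"
      using spC by simp
    have "fun_upd \<omega> n x = ?\<pi> (Suc n) \<longleftrightarrow> \<omega> = ?\<pi> n \<and> x = \<pi> n" for x
    proof
      assume eq: "fun_upd \<omega> n x = ?\<pi> (Suc n)"
      have "\<omega> i = ?\<pi> n i" for i
        using fun_cong[OF eq, of i] \<omega>
        by (cases "i < n"; cases "i = n") (auto simp: space_PiM PiE_iff extensional_def)
      then show "\<omega> = ?\<pi> n \<and> x = \<pi> n"
        using fun_cong[OF eq, of n] by auto
    next
      assume "\<omega> = ?\<pi> n \<and> x = \<pi> n"
      then show "fun_upd \<omega> n x = ?\<pi> (Suc n)"
        by (auto simp: fun_eq_iff)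
    qed
    then have "fun_upd \<omega> n -` {?\<pi> (Suc n)} \<inter> UNIV = (if \<omega> = ?\<pi> n then {\<pi> n} else {})"
      by auto
    moreover have "chain_step K s0 n (?\<pi> n) = chain_step K s0 n \<pi>"
      by (auto simp: chain_step_def)
    ultimately show "emeasure (chain.eP K s0 n \<omega>) {?\<pi> (Suc n)} =
        emeasure (chain_step K s0 n \<pi>) {\<pi> n} * indicator {?\<pi> n} \<omega>"
      using chain.emeasure_eP[OF \<omega> singleton, of K s0] by auto
  qed
  also have "\<dots> = emeasure (chain_step K s0 n \<pi>) {\<pi> n} * emeasure ?C {?\<pi> n}"
    using singleton[of n] chain.sets_C[OF u, of K s0 n] by (simp add: nn_integral_cmult_indicator)
  finally show ?case
    unfolding Suc.IH prod.lessThan_Suc by (simp only: mult.commute)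
qed

lemma emeasure_cylinder:
  "emeasure (path_measure M) {\<omega>. \<forall>i\<le>n. \<omega> i = \<pi> i} =
    (if \<pi> 0 = initial M then \<Prod>i<n. ennreal (pmf (transition M (\<pi> i)) (\<pi> (Suc i))) else 0)"
proof -
  let ?J = "{0..<Suc n}"
  let ?X = "PiE ?J (\<lambda>i. {\<pi> i})"
  have X: "?X = {restrict \<pi> ?J}"
    by (auto simp: PiE_iff fun_eq_iff extensional_def)
  have setsX: "?X \<in> sets (PiM ?J (\<lambda>_. count_space UNIV))"
    by (rule sets_PiM_I_finite) auto
  have "{\<omega>. \<forall>i\<le>n. \<omega> i = \<pi> i} = chain.PF.emb UNIV ?J ?X"
    by (auto simp: prod_emb_def space_PiM PiE_iff less_Suc_eq_le)
  then have "emeasure (path_measure M) {\<omega>. \<forall>i\<le>n. \<omega> i = \<pi> i} = emeasure (chain.CI (transition M) (initial M) ?J) ?X"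
    using chain.lim[OF _ setsX, of "transition M" "initial M"] by (simp add: path_measure_def)
  also have "\<dots> = emeasure (chain.C (transition M) (initial M) 0 (Suc n) (\<lambda>_. undefined)) ?X"
    using chain.emeasure_CI[OF _ setsX, of "Suc n" "transition M" "initial M"] sets.sets_into_space[OF setsX]
    by (simp add: prod_emb_id)
  also have "\<dots> = (\<Prod>i<Suc n. emeasure (chain_step (transition M) (initial M) i \<pi>) {\<pi> i})"
    unfolding X by (rule emeasure_path_prefix)
  also have "\<dots> = emeasure (chain_step (transition M) (initial M) 0 \<pi>) {\<pi> 0} *
      (\<Prod>i<n. emeasure (chain_step (transition M) (initial M) (Suc i) \<pi>) {\<pi> (Suc i)})"
    by (rule prod.lessThan_Suc_shift)
  finally show ?thesis
    by (simp add: chain_step_def emeasure_pmf_single)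
qed

definition models_event ::
    "('s, 'a) markov_chain \<Rightarrow> ('x \<Rightarrow> nat) \<Rightarrow> ('a, 'x) pltl \<Rightarrow> (nat \<Rightarrow> 's) set" where
  "models_event M v \<phi> = {\<omega>. sat (\<lambda>i. label M (\<omega> i)) 0 v \<phi>}"

lemma models_event_sets [measurable]: "models_event M v \<phi> \<in> sets (path_measure M)"
proof -
  have [measurable]: "(\<lambda>\<omega>. \<omega> i) \<in> measurable (path_measure M) (count_space UNIV)" for i
    unfolding measurable_cong_sets[OF sets_path_measure refl]
    by (rule measurable_component_singleton) simp
  have "Measurable.pred (path_measure M) (\<lambda>\<omega>. sat (\<lambda>i. label M (\<omega> i)) k v \<phi>)" for k
  proof (induction \<phi> arbitrary: k)
    case (Prop a)
    show ?case
      using measurable_compose[of "\<lambda>\<omega>. \<omega> k" "path_measure M" "count_space UNIV"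
          "\<lambda>s. a \<in> label M s" "count_space UNIV"] by simp
  next
    case (NegProp a)
    show ?case
      using measurable_compose[of "\<lambda>\<omega>. \<omega> k" "path_measure M" "count_space UNIV"
          "\<lambda>s. a \<notin> label M s" "count_space UNIV"] by simp
  next
    case (Until \<phi> \<psi>)
    note Until.IH[measurable]
    show ?case by simp
  next
    case (Release \<phi> \<psi>)
    note Release.IH[measurable]
    show ?case by simp
  next
    case (Always \<phi>)
    note Always.IH[measurable]
    show ?case by simp
  next
    case (EvVar x \<phi>)
    note EvVar.IH[measurable]
    show ?case by simp
  next
    case (EvConst c \<phi>)
    note EvConst.IH[measurable]
    show ?case by simp
  next
    case (AlwConst c \<phi>)
    note AlwConst.IH[measurable]
    show ?case by simp
  qed simp_all
  then have "Measurable.pred (path_measure M) (\<lambda>\<omega>. sat (\<lambda>i. label M (\<omega> i)) 0 v \<phi>)" .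
  then show ?thesis
    by (simp add: models_event_def pred_def)
qed

definition V_eq1 :: "('s, 'a) markov_chain \<Rightarrow> ('a, 'x) pltl \<Rightarrow> ('x \<Rightarrow> nat) set" where
  "V_eq1 M \<phi> = {v. measure (path_measure M) (models_event M v \<phi>) = 1}"

end

theory Submission
  imports Defs "HOL-Library.Omega_Words_Fun"
begin

text \<open>
  Call a path fair if every finite path that starts in a state visited infinitely often is itself
  traversed infinitely often. Almost all paths are fair, and on fair paths the truth of a formula is
  decided by a finite prefix, because \<open>Always \<psi>\<close> can hold only if the path reaches a state from which
  \<open>\<psi>\<close> is forced forever. So a formula holds almost surely iff it holds on all fair paths, and the truth
  or falsity of a formula on a fair path is witnessed by a finite word whose letters may also be asked
  whether some subformula is forced there.

  A shortest witness of truth has at most \<open>m * 2^n\<close> letters, where \<open>n\<close> is the number of temporal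
  subformulas, since a repeated pair of a state and a set of true subformulas can be cut out; this
  bounds all waiting times. For falsity under the bound \<open>N\<close>, mark the word in blocks of length
  at most \<open>N / 2\<close>. If \<open>EvVar x \<psi>\<close> fails, then \<open>\<psi>\<close> fails through at least two
  marks, and this weaker property survives pumping a repetition inside every block to arbitrary length, after
  which it refutes \<open>EvVar x \<psi>\<close> for arbitrarily large bounds. By induction on the formula the forced
  subformulas, hence the witnesses, are the same for \<open>N\<close> and for all larger bounds.
\<close>

section \<open>Co-safe formulas on finite marked words\<close>

text \<open>
  Letters are pairs of a state and a mark, and marks end the blocks of a word. \<open>Thru f\<close> asks that
  \<open>f\<close> holds up to and including the second mark from now on; it replaces the statement that
  \<open>f\<close> holds for \<open>v x\<close> steps.
\<close>

datatype 's cosafe =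
    Atom "'s set"
  | Conj "'s cosafe" "'s cosafe"
  | Disj "'s cosafe" "'s cosafe"
  | Nxt "'s cosafe"
  | Unt "'s cosafe" "'s cosafe"
  | Thru "'s cosafe"

primrec until_list :: "('b list \<Rightarrow> bool) \<Rightarrow> ('b list \<Rightarrow> bool) \<Rightarrow> 'b list \<Rightarrow> bool" where
  "until_list P Q [] \<longleftrightarrow> False"
| "until_list P Q (x # xs) \<longleftrightarrow> Q (x # xs) \<or> P (x # xs) \<and> until_list P Q xs"

primrec thru1 :: "(('s \<times> bool) list \<Rightarrow> bool) \<Rightarrow> ('s \<times> bool) list \<Rightarrow> bool" where
  "thru1 P [] \<longleftrightarrow> False"
| "thru1 P (x # xs) \<longleftrightarrow> P (x # xs) \<and> (snd x \<or> thru1 P xs)"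

primrec thru2 :: "(('s \<times> bool) list \<Rightarrow> bool) \<Rightarrow> ('s \<times> bool) list \<Rightarrow> bool" where
  "thru2 P [] \<longleftrightarrow> False"
| "thru2 P (x # xs) \<longleftrightarrow> P (x # xs) \<and> (if snd x then thru1 P xs else thru2 P xs)"

primrec csat :: "'s cosafe \<Rightarrow> ('s \<times> bool) list \<Rightarrow> bool" where
  "csat (Atom A) xs \<longleftrightarrow> xs \<noteq> [] \<and> fst (hd xs) \<in> A"
| "csat (Conj f g) xs \<longleftrightarrow> csat f xs \<and> csat g xs"
| "csat (Disj f g) xs \<longleftrightarrow> csat f xs \<or> csat g xs"
| "csat (Nxt f) xs \<longleftrightarrow> csat f (tl xs)"
| "csat (Unt f g) xs \<longleftrightarrow> until_list (csat f) (csat g) xs"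
| "csat (Thru f) xs \<longleftrightarrow> thru2 (csat f) xs"

lemma csat_Nil [simp]: "\<not> csat f []"
  by (induction f) auto

lemma until_list_mono:
  assumes "\<And>xs. P xs \<Longrightarrow> P (xs @ ys)" "\<And>xs. Q xs \<Longrightarrow> Q (xs @ ys)"
  shows "until_list P Q xs \<Longrightarrow> until_list P Q (xs @ ys)"
proof (induction xs)
  case (Cons x xs)
  then show ?case
    using assms[of "x # xs"] by auto
qed simp

lemma thru1_mono:
  assumes "\<And>xs. P xs \<Longrightarrow> P (xs @ ys)"
  shows "thru1 P xs \<Longrightarrow> thru1 P (xs @ ys)"
proof (induction xs)
  case (Cons x xs)
  then show ?case
    using assms[of "x # xs"] by auto
qed simp

lemma thru2_mono:
  assumes "\<And>xs. P xs \<Longrightarrow> P (xs @ ys)"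
  shows "thru2 P xs \<Longrightarrow> thru2 P (xs @ ys)"
proof (induction xs)
  case (Cons x xs)
  then show ?case
    using assms[of "x # xs"] thru1_mono[of P ys xs, OF assms] by (auto split: if_splits)
qed simp

text \<open>Co-safety: nothing holds on the empty word, so every demand of a formula is met at
  positions inside \<open>xs\<close>, and letters appended behind cannot undo it.\<close>

lemma csat_append: "csat f xs \<Longrightarrow> csat f (xs @ ys)"
proof (induction f arbitrary: xs)
  case (Nxt f)
  then show ?case by (cases xs) auto
qed (auto intro: until_list_mono thru2_mono)

lemma until_list_iff:
  "until_list P Q xs \<longleftrightarrow> (\<exists>j<length xs. Q (drop j xs) \<and> (\<forall>k<j. P (drop k xs)))"
proof (induction xs)
  case (Cons x xs)
  show ?case
    by (auto simp: Cons.IH Ex_less_Suc2 All_less_Suc2)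
qed simp

lemma thru1_I: "p < length xs \<Longrightarrow> snd (xs ! p) \<Longrightarrow> (\<And>j. j \<le> p \<Longrightarrow> P (drop j xs)) \<Longrightarrow> thru1 P xs"
proof (induction xs arbitrary: p)
  case (Cons x xs)
  have P: "P (x # xs)"
    using Cons.prems(3)[of 0] by simp
  show ?case
  proof (cases p)
    case (Suc p')
    have "thru1 P xs"
      using Cons.prems Suc Cons.prems(3)[of "Suc _"] by (intro Cons.IH[of p']) auto
    then show ?thesis using P by simp
  qed (use P Cons.prems in simp)
qed simp

lemma thru2_I:
  "p < q \<Longrightarrow> q < length xs \<Longrightarrow> snd (xs ! p) \<Longrightarrow> snd (xs ! q) \<Longrightarrow> (\<And>j. j \<le> q \<Longrightarrow> P (drop j xs))
    \<Longrightarrow> thru2 P xs"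
proof (induction xs arbitrary: p q)
  case (Cons x xs)
  have P: "P (x # xs)"
    using Cons.prems(5)[of 0] by simp
  obtain q' where q: "q = Suc q'"
    using Cons.prems(1) by (cases q) auto
  have P': "P (drop j xs)" if "j \<le> q'" for j
    using Cons.prems(5)[of "Suc j"] that q by simp
  have one: "thru1 P xs"
    using Cons.prems q P' by (intro thru1_I[of q']) auto
  show ?case
  proof (cases p)
    case (Suc p')
    have "thru2 P xs"
      using Cons.prems Suc q P' by (intro Cons.IH[of p' q']) auto
    then show ?thesis using P one by simp
  qed (use P one Cons.prems in simp)
qed simp

text \<open>The first \<open>d\<close> letters are unmarked, and so are the \<open>K\<close> letters after each mark.\<close>

primrec spaced :: "nat \<Rightarrow> nat \<Rightarrow> ('s \<times> bool) list \<Rightarrow> bool" where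
  "spaced K d [] \<longleftrightarrow> True"
| "spaced K d (x # xs) \<longleftrightarrow> (if snd x then d = 0 \<and> spaced K K xs else spaced K (d - 1) xs)"

lemma spaced_mono: "spaced K d xs \<Longrightarrow> e \<le> d \<Longrightarrow> spaced K e xs"
proof (induction xs arbitrary: d e)
  case (Cons x xs)
  then show ?case
    by (auto split: if_splits intro: Cons.IH[of "d - 1"])
qed simp

lemma spaced_drop: "spaced K 0 xs \<Longrightarrow> spaced K 0 (drop j xs)"
proof (induction j arbitrary: xs)
  case (Suc j)
  then show ?case
    by (cases xs) (auto split: if_splits intro: Suc.IH spaced_mono)
qed simp

lemma thru1_spaced: "spaced K d xs \<Longrightarrow> thru1 P xs \<Longrightarrow> j \<le> d \<Longrightarrow> P (drop j xs)"
proof (induction xs arbitrary: d j)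
  case (Cons x xs)
  show ?case
  proof (cases j)
    case (Suc j')
    then show ?thesis
      using Cons.prems Cons.IH[of "d - 1" j'] by (auto split: if_splits)
  qed (use Cons.prems in simp)
qed simp

text \<open>The first mark may come at once, but the second is then still more than \<open>K\<close>
  letters away. Asking for two marks thus covers the positions up to \<open>K\<close> whatever
  \<open>d\<close> is, which a single mark would not.\<close>

lemma thru2_spaced: "spaced K d xs \<Longrightarrow> thru2 P xs \<Longrightarrow> j \<le> K \<Longrightarrow> P (drop j xs)"
proof (induction xs arbitrary: d j)
  case (Cons x xs)
  show ?case
  proof (cases j)
    case (Suc j')
    then show ?thesis
      using Cons.prems Cons.IH[of "d - 1" j'] thru1_spaced[of K K xs P j'] by (auto split: if_splits)
  qed (use Cons.prems in simp)
qed simp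

lemma thru2_imp_thru1: "thru2 P xs \<Longrightarrow> thru1 P xs"
  by (induction xs) (auto split: if_splits)

section \<open>Agreement of words and repetitions inside a block\<close>

definition unmarked :: "'s list \<Rightarrow> ('s \<times> bool) list" where
  "unmarked z = map (\<lambda>s. (s, False)) z"

lemma unmarked_simps [simp]:
  "unmarked [] = []" "unmarked (s # z) = (s, False) # unmarked z"
  "unmarked (y @ z) = unmarked y @ unmarked z" "length (unmarked z) = length z"
  "map fst (unmarked z) = z" "unmarked z = [] \<longleftrightarrow> z = []"
  by (auto simp: unmarked_def comp_def)

lemma spaced_unmarked: "spaced K d (unmarked z @ xs) \<longleftrightarrow> spaced K (d - length z) xs"
  by (induction z arbitrary: d) auto

lemma thru2_unmarked: "thru2 P (unmarked z @ R) \<longleftrightarrow> thru1 P (unmarked z @ R) \<and> thru2 P R"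
  by (induction z) (auto intro: thru2_imp_thru1)

text \<open>Agreement on \<open>f\<close> alone is not preserved when a letter is put in front, so
  all subformulas are compared. For \<open>Thru f\<close> the value of \<open>thru1\<close> is
  recorded too, because \<open>thru2\<close> falls back on it after a marked letter.\<close>

primrec eqv :: "'s cosafe \<Rightarrow> ('s \<times> bool) list \<Rightarrow> ('s \<times> bool) list \<Rightarrow> bool" where
  "eqv (Atom A) xs ys \<longleftrightarrow> csat (Atom A) xs = csat (Atom A) ys"
| "eqv (Conj f g) xs ys \<longleftrightarrow> eqv f xs ys \<and> eqv g xs ys"
| "eqv (Disj f g) xs ys \<longleftrightarrow> eqv f xs ys \<and> eqv g xs ys"
| "eqv (Nxt f) xs ys \<longleftrightarrow> eqv f xs ys \<and> csat (Nxt f) xs = csat (Nxt f) ys"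
| "eqv (Unt f g) xs ys \<longleftrightarrow> eqv f xs ys \<and> eqv g xs ys \<and> csat (Unt f g) xs = csat (Unt f g) ys"
| "eqv (Thru f) xs ys \<longleftrightarrow> eqv f xs ys \<and> thru1 (csat f) xs = thru1 (csat f) ys
     \<and> thru2 (csat f) xs = thru2 (csat f) ys"

lemma eqv_csat: "eqv f xs ys \<Longrightarrow> csat f xs = csat f ys"
  by (induction f) auto

lemma eqv_refl [simp]: "eqv f xs xs"
  by (induction f) auto

lemma eqv_trans: "eqv f xs ys \<Longrightarrow> eqv f ys zs \<Longrightarrow> eqv f xs zs"
  by (induction f) auto

lemma eqv_sym: "eqv f xs ys \<Longrightarrow> eqv f ys xs"
  by (induction f) auto

lemma eqv_Cons: "eqv f xs ys \<Longrightarrow> eqv f (x # xs) (x # ys)"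
proof (induction f)
  case (Unt f g)
  then show ?case
    using eqv_csat[of f "x # xs" "x # ys"] eqv_csat[of g "x # xs" "x # ys"] by auto
next
  case (Thru f)
  then show ?case
    using eqv_csat[of f "x # xs" "x # ys"] by auto
next
  case (Nxt f)
  then show ?case
    using eqv_csat[of f xs ys] by auto
qed auto

lemma eqv_append: "eqv f xs ys \<Longrightarrow> eqv f (zs @ xs) (zs @ ys)"
  by (induction zs) (auto intro: eqv_Cons)

primrec temporals :: "'s cosafe \<Rightarrow> 's cosafe set" where
  "temporals (Atom A) = {}"
| "temporals (Conj f g) = temporals f \<union> temporals g"
| "temporals (Disj f g) = temporals f \<union> temporals g"
| "temporals (Nxt f) = insert (Nxt f) (temporals f)"
| "temporals (Unt f g) = insert (Unt f g) (temporals f \<union> temporals g)"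
| "temporals (Thru f) = insert (Thru f) (temporals f)"

lemma finite_temporals [simp]: "finite (temporals f)"
  by (induction f) auto

text \<open>
  One bit per temporal subformula. For \<open>Thru f\<close> it is \<open>thru1\<close>, because within one block
  \<open>thru2\<close> is \<open>thru1\<close> in conjunction with a condition on the word behind that block.
\<close>

definition profile_bit :: "('s \<times> bool) list \<Rightarrow> 's cosafe \<Rightarrow> bool" where
  "profile_bit xs g \<longleftrightarrow> (case g of Thru f \<Rightarrow> thru1 (csat f) xs | _ \<Rightarrow> csat g xs)"

text \<open>Atoms see only the first letter. Both words carry all their marks in the common
  remainder \<open>R\<close>, so by \<open>thru2_unmarked\<close> the bit for \<open>thru1\<close>
  also fixes \<open>thru2\<close>.\<close>

lemma eqv_unmarked:
  assumes "y \<noteq> []" "z \<noteq> []" "hd y = hd z"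
    and "\<forall>g \<in> temporals f. profile_bit (unmarked y @ R) g = profile_bit (unmarked z @ R) g"
  shows "eqv f (unmarked y @ R) (unmarked z @ R)"
  using assms(4)
proof (induction f)
  case (Atom A)
  show ?case
    using assms(1-3) by (cases y; cases z) simp_all
next
  case (Thru f)
  have "eqv f (unmarked y @ R) (unmarked z @ R)"
    by (rule Thru.IH) (use Thru.prems in simp)
  moreover have "thru1 (csat f) (unmarked y @ R) = thru1 (csat f) (unmarked z @ R)"
    using Thru.prems by (simp add: profile_bit_def)
  ultimately show ?case
    by (simp add: thru2_unmarked)
next
  case (Nxt f)
  have "eqv f (unmarked y @ R) (unmarked z @ R)"
    by (rule Nxt.IH) (use Nxt.prems in simp)
  moreover have "csat (Nxt f) (unmarked y @ R) = csat (Nxt f) (unmarked z @ R)"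
    using Nxt.prems by (simp add: profile_bit_def)
  ultimately show ?case
    by simp
next
  case (Unt f g)
  have "eqv f (unmarked y @ R) (unmarked z @ R)" "eqv g (unmarked y @ R) (unmarked z @ R)"
    by (rule Unt.IH; use Unt.prems in simp)+
  moreover have "csat (Unt f g) (unmarked y @ R) = csat (Unt f g) (unmarked z @ R)"
    using Unt.prems by (simp add: profile_bit_def)
  ultimately show ?case
    by simp
qed (simp_all add: ball_Un)

text \<open>Pigeonhole on the pairs of a letter and the set of true bits, evaluated on the rest of
  \<open>z\<close> followed by \<open>R\<close>. The factor \<open>q\<close> between two equal pairs
  can be removed or repeated in front of \<open>r\<close>; equal heads keep the result a
  path.\<close>

lemma repetition:
  fixes z :: "'s :: finite list"
  assumes long: "CARD('s) * 2 ^ card (temporals f) < length z"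
  obtains p q r where "z = p @ q @ r" "q \<noteq> []" "r \<noteq> []" "hd q = hd r"
    "eqv f (unmarked (q @ r) @ R) (unmarked r @ R)"
proof -
  define prof where "prof i = (z ! i, {g \<in> temporals f. profile_bit (unmarked (drop i z) @ R) g})" for i
  have "card (prof ` {..<length z}) \<le> card ((UNIV :: 's set) \<times> Pow (temporals f))"
    by (rule card_mono) (auto simp: prof_def)
  also have "\<dots> < card {..<length z}"
    using long by (simp add: card_cartesian_product card_Pow)
  finally have "\<not> inj_on prof {..<length z}"
    by (rule pigeonhole)
  then obtain i j where ij: "i < j" "j < length z" and prof: "prof i = prof j"
    using linorder_inj_onI'[of "{..<length z}" prof] lessThan_iff by blast
  define p where "p = take i z"
  define q where "q = drop i (take j z)"
  define r where "r = drop j z"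
  have i: "drop i z = q @ r"
    using ij by (simp add: q_def r_def drop_take)
      (metis append_take_drop_id drop_drop le_add_diff_inverse2 less_imp_le_nat)
  show thesis
  proof (rule that[of p q r])
    show "z = p @ q @ r"
      by (metis append_take_drop_id i p_def)
    show "q \<noteq> []" "r \<noteq> []"
      using ij by (auto simp: q_def r_def)
    have "hd (q @ r) = z ! i"
      unfolding i[symmetric] using ij by (simp add: hd_drop_conv_nth)
    moreover have "hd r = z ! j"
      using ij by (simp add: r_def hd_drop_conv_nth)
    moreover have "z ! i = z ! j" and bits: "{g \<in> temporals f. profile_bit (unmarked (drop i z) @ R) g}
        = {g \<in> temporals f. profile_bit (unmarked (drop j z) @ R) g}"
      using prof by (simp_all add: prof_def)
    ultimately show "hd q = hd r"
      using \<open>q \<noteq> []\<close> by simp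
    show "eqv f (unmarked (q @ r) @ R) (unmarked r @ R)"
    proof (rule eqv_unmarked)
      show "hd (q @ r) = hd r"
        using \<open>q \<noteq> []\<close> \<open>hd q = hd r\<close> by simp
      show "\<forall>g \<in> temporals f. profile_bit (unmarked (q @ r) @ R) g = profile_bit (unmarked r @ R) g"
        using bits unfolding i r_def[symmetric] by blast
    qed (use \<open>q \<noteq> []\<close> \<open>r \<noteq> []\<close> in simp_all)
  qed
qed

section \<open>Fair paths and determination by finite prefixes\<close>

abbreviation lpath :: "('s \<Rightarrow> 's set) \<Rightarrow> 's list \<Rightarrow> bool" where
  "lpath E \<equiv> successively (\<lambda>s t. t \<in> E s)"

definition fair :: "('s \<Rightarrow> 's set) \<Rightarrow> 's word \<Rightarrow> bool" where
  "fair E w \<longleftrightarrow> (\<forall>n. w (Suc n) \<in> E (w n)) \<and>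
     (\<forall>u. u \<noteq> [] \<longrightarrow> lpath E u \<longrightarrow> hd u \<in> limit w \<longrightarrow> (\<exists>\<^sub>\<infinity>n. subsequence w n (n + length u) = u))"

lemma fair_edge: "fair E w \<Longrightarrow> w (Suc n) \<in> E (w n)"
  by (simp add: fair_def)

lemma lpath_subsequence:
  assumes "\<And>n. w (Suc n) \<in> E (w n)"
  shows "lpath E (subsequence w i j)"
proof (induction j)
  case (Suc j)
  show ?case
  proof (cases "i \<le> j")
    case True
    then show ?thesis
      using Suc assms[of "j - 1"] by (cases "i = j") (auto simp: successively_append_iff last_conv_nth)
  qed simp
qed simp

lemma fair_suffix:
  assumes "fair E w"
  shows "fair E (suffix i w)"
proof -
  have "\<exists>\<^sub>\<infinity>n. subsequence (suffix i w) n (n + length u) = u"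
    if "u \<noteq> []" "lpath E u" "hd u \<in> limit w" for u
  proof -
    have "\<exists>\<^sub>\<infinity>n. subsequence w n (n + length u) = u"
      using that assms by (simp add: fair_def)
    then have *: "\<exists>n>m + i. subsequence w n (n + length u) = u" for m
      by (simp add: INFM_nat)
    show ?thesis
      unfolding INFM_nat
    proof
      fix m
      obtain n where "n > m + i" "subsequence w n (n + length u) = u"
        using * by blast
      then show "\<exists>n>m. subsequence (suffix i w) n (n + length u) = u"
        by (intro exI[of _ "n - i"]) auto
    qed
  qed
  then show ?thesis
    using assms by (simp add: fair_def)
qed

text \<open>A finite word in front changes neither the recurrent states nor the factors that recur,
  so only the edges inside \<open>xs\<close> and at the seam matter.\<close>

lemma fair_conc:
  assumes "fair E w" "lpath E (xs @ [w 0])"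
  shows "fair E (xs \<frown> w)"
proof -
  have "(xs \<frown> w) (Suc n) \<in> E ((xs \<frown> w) n)" for n
  proof -
    consider "Suc n < length xs" | "Suc n = length xs" | "Suc n > length xs"
      by linarith
    then show ?thesis
    proof cases
      case 1
      then show ?thesis
        using assms(2) successively_nth[of _ xs n] by (auto simp: successively_append_iff)
    next
      case 2
      then have "xs \<noteq> []" "last xs = xs ! n"
        by (cases xs rule: rev_cases; auto)+
      then show ?thesis
        using assms(2) 2 by (auto simp: successively_append_iff)
    next
      case 3
      then show ?thesis
        using fair_edge[OF assms(1), of "n - length xs"] by (simp add: Suc_diff_le)
    qed
  qed
  moreover have "\<exists>\<^sub>\<infinity>n. subsequence (xs \<frown> w) n (n + length u) = u"
    if "u \<noteq> []" "lpath E u" "hd u \<in> limit w" for u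
  proof -
    have "\<exists>\<^sub>\<infinity>n. subsequence w n (n + length u) = u"
      using that assms by (simp add: fair_def)
    then have *: "\<exists>n>m. subsequence w n (n + length u) = u" for m
      by (simp add: INFM_nat)
    show ?thesis
      unfolding INFM_nat
    proof
      fix m
      obtain n where n: "n > m" "subsequence w n (n + length u) = u"
        using * by blast
      have "subsequence (xs \<frown> w) (length xs + n) (length xs + n + length u) = u"
        using n(2) subsequence_shift[of "length xs" "xs \<frown> w" n "n + length u"]
        by (simp add: add.assoc)
      then show "\<exists>n>m. subsequence (xs \<frown> w) n (n + length u) = u"
        using n(1) by (intro exI[of _ "length xs + n"]) auto
    qed
  qed
  ultimately show ?thesis
    by (simp add: fair_def)
qed

text \<open>In topological terms, \<open>P\<close> is clopen in the space of fair words.\<close>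

definition prefix_determined :: "('s \<Rightarrow> 's set) \<Rightarrow> ('s word \<Rightarrow> bool) \<Rightarrow> bool" where
  "prefix_determined E P \<longleftrightarrow> (\<forall>w. fair E w \<longrightarrow>
     (\<exists>n. \<forall>w'. fair E w' \<longrightarrow> (\<forall>i<n. w' i = w i) \<longrightarrow> P w' = P w))"

lemma detI:
  assumes "\<And>w. fair E w \<Longrightarrow> \<exists>n. \<forall>w'. fair E w' \<longrightarrow> (\<forall>i<n. w' i = w i) \<longrightarrow> P w' = P w"
  shows "prefix_determined E P"
  using assms by (simp add: prefix_determined_def)

lemma detE:
  assumes "prefix_determined E P" "fair E w"
  obtains n where "\<And>w'. fair E w' \<Longrightarrow> (\<And>i. i < n \<Longrightarrow> w' i = w i) \<Longrightarrow> P w' = P w"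
  using assms unfolding prefix_determined_def by blast

lemma det_state: "prefix_determined E (\<lambda>w. A (w 0))"
  by (intro detI exI[of _ 1]) simp

lemma det_not: "prefix_determined E P \<Longrightarrow> prefix_determined E (\<lambda>w. \<not> P w)"
  by (simp add: prefix_determined_def)

lemma det_conj:
  assumes "prefix_determined E P" "prefix_determined E Q"
  shows "prefix_determined E (\<lambda>w. P w \<and> Q w)"
proof (rule detI)
  fix w
  assume w: "fair E w"
  obtain m where m: "\<And>w'. fair E w' \<Longrightarrow> (\<And>i. i < m \<Longrightarrow> w' i = w i) \<Longrightarrow> P w' = P w"
    using detE[OF assms(1) w] by metis
  obtain n where n: "\<And>w'. fair E w' \<Longrightarrow> (\<And>i. i < n \<Longrightarrow> w' i = w i) \<Longrightarrow> Q w' = Q w"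
    using detE[OF assms(2) w] by metis
  show "\<exists>n. \<forall>w'. fair E w' \<longrightarrow> (\<forall>i<n. w' i = w i) \<longrightarrow> (P w' \<and> Q w') = (P w \<and> Q w)"
    using m n by (intro exI[of _ "max m n"]) auto
qed

lemma det_disj: "prefix_determined E P \<Longrightarrow> prefix_determined E Q \<Longrightarrow> prefix_determined E (\<lambda>w. P w \<or> Q w)"
  using det_not[OF det_conj[OF det_not det_not, of E P Q]] by simp

lemma det_suffix:
  assumes "prefix_determined E P"
  shows "prefix_determined E (\<lambda>w. P (suffix k w))"
proof (rule detI)
  fix w
  assume w: "fair E w"
  obtain n where n: "\<And>w'. fair E w' \<Longrightarrow> (\<And>i. i < n \<Longrightarrow> w' i = suffix k w i) \<Longrightarrow> P w' = P (suffix k w)"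
    using detE[OF assms fair_suffix[OF w]] by metis
  show "\<exists>n. \<forall>w'. fair E w' \<longrightarrow> (\<forall>i<n. w' i = w i) \<longrightarrow> P (suffix k w') = P (suffix k w)"
    by (intro exI[of _ "k + n"] allI impI n fair_suffix) auto
qed

lemma det_All_less:
  assumes "prefix_determined E P"
  shows "prefix_determined E (\<lambda>w. \<forall>k<j. P (suffix k w))"
proof (induction j)
  case (Suc j)
  have "prefix_determined E (\<lambda>w. (\<forall>k<j. P (suffix k w)) \<and> P (suffix j w))"
    by (intro det_conj Suc det_suffix assms)
  moreover have "(\<forall>k<Suc j. P (suffix k w)) \<longleftrightarrow> (\<forall>k<j. P (suffix k w)) \<and> P (suffix j w)" for w
    by (auto simp: less_Suc_eq)
  ultimately show ?case
    by (simp only:)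
qed (use det_state[of E "\<lambda>_. True"] in simp)

lemma det_Ex_less: "prefix_determined E P \<Longrightarrow> prefix_determined E (\<lambda>w. \<exists>k<j. P (suffix k w))"
  using det_not[OF det_All_less[OF det_not, of E P j]] by simp

definition forced :: "('s \<Rightarrow> 's set) \<Rightarrow> ('s word \<Rightarrow> bool) \<Rightarrow> 's set" where
  "forced E P = {s. \<forall>w. fair E w \<longrightarrow> w 0 = s \<longrightarrow> (\<forall>i. P (suffix i w))}"

lemma forced_suffix: "fair E w \<Longrightarrow> w j \<in> forced E P \<Longrightarrow> i \<ge> j \<Longrightarrow> P (suffix i w)"
  using fair_suffix[of E w j] unfolding forced_def
  by (auto dest!: spec[of _ "suffix j w"] spec[of _ "i - j"])

text \<open>Any state \<open>s\<close> that recurs in \<open>w\<close> will do. If a fair word from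
  \<open>s\<close> violated \<open>P\<close> at some suffix, a finite prefix of it would already
  decide this; that prefix is a path from a recurrent state, so it occurs in \<open>w\<close>, and a
  suffix of \<open>w\<close> would violate \<open>P\<close>.\<close>

lemma forced_recurrent:
  fixes w :: "'s :: finite word"
  assumes "prefix_determined E P" and w: "fair E w" and all: "\<And>j. P (suffix j w)"
  shows "\<exists>j. w j \<in> forced E P"
proof -
  obtain s where s: "s \<in> limit w"
    using limit_nonempty[of w] by auto
  then obtain j where j: "w j = s"
    using INFM_EX[of "\<lambda>n. w n = s"] by (auto simp: limit_def)
  have "P (suffix i w')" if w': "fair E w'" "w' 0 = s" for w' i
  proof -
    obtain n where n: "\<And>w''. fair E w'' \<Longrightarrow> (\<And>k. k < n \<Longrightarrow> w'' k = suffix i w' k) \<Longrightarrow> P w'' = P (suffix i w')"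
      using detE[OF assms(1) fair_suffix[OF w'(1)]] by metis
    \<comment> \<open>The successor keeps \<open>u\<close> nonempty even when \<open>i + n\<close>
      is 0.\<close>
    define u where "u = prefix (Suc (i + n)) w'"
    have "u \<noteq> []" "lpath E u" "hd u \<in> limit w"
      using s w' lpath_subsequence[of w' E, OF fair_edge[OF w'(1)]] by (simp_all add: u_def hd_conv_nth del: subseq_to_Suc)
    then have "\<exists>\<^sub>\<infinity>m. subsequence w m (m + length u) = u"
      using w by (simp add: fair_def)
    then obtain m where m: "subsequence w m (m + length u) = u"
      using INFM_EX by blast
    have "w (m + k) = w' k" if "k \<le> i + n" for k
      using that arg_cong[OF m, of "\<lambda>xs. xs ! k"] by (simp add: u_def del: subseq_to_Suc)
    then have "P (suffix (m + i) w) = P (suffix i w')"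
      by (intro n fair_suffix w) (simp add: add.assoc)
    then show ?thesis
      using all by simp
  qed
  then show ?thesis
    using j by (auto simp: forced_def)
qed

text \<open>\<open>R\<close> is a clopen neighbourhood of \<open>w\<close> on which \<open>U\<close>
  is constant.\<close>

lemma det_transfer:
  assumes "prefix_determined E R" "fair E w" "R w" "\<And>w'. fair E w' \<Longrightarrow> R w' \<Longrightarrow> U w' = U w"
  shows "\<exists>n. \<forall>w'. fair E w' \<longrightarrow> (\<forall>i<n. w' i = w i) \<longrightarrow> U w' = U w"
proof -
  obtain n where "\<And>w'. fair E w' \<Longrightarrow> (\<And>i. i < n \<Longrightarrow> w' i = w i) \<Longrightarrow> R w' = R w"
    using detE[OF assms(1,2)] by metis
  then show ?thesis
    using assms(3,4) by (intro exI[of _ n]) simp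
qed

text \<open>Three finite observations settle an until: \<open>Q\<close> is reached with
  \<open>P\<close> holding before; \<open>P\<close> fails while \<open>Q\<close> has not yet held;
  or, if \<open>Q\<close> never holds, the word enters a state where \<open>\<not> Q\<close> is
  forced, by \<open>forced_recurrent\<close>. The third one is where fairness enters.\<close>

lemma det_until:
  fixes P Q :: "'s :: finite word \<Rightarrow> bool"
  assumes P: "prefix_determined E P" and Q: "prefix_determined E Q"
  shows "prefix_determined E (\<lambda>w. \<exists>j. Q (suffix j w) \<and> (\<forall>k<j. P (suffix k w)))" (is "prefix_determined E ?U")
proof (rule detI)
  fix w
  assume w: "fair E w"
  consider (sat) j where "Q (suffix j w)" "\<forall>k<j. P (suffix k w)"
    | (stop) j where "\<not> P (suffix j w)" "\<forall>k<Suc j. \<not> Q (suffix k w)"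
    | (never) "\<And>j. \<not> Q (suffix j w)"
  proof (cases "\<exists>j. Q (suffix j w)")
    case True
    define j where "j = (LEAST j. Q (suffix j w))"
    have j: "Q (suffix j w)" "\<not> Q (suffix k w)" if "k < j" for k
      using LeastI_ex[OF True] that not_less_Least[of k "\<lambda>j. Q (suffix j w)"] by (auto simp: j_def)
    show thesis
    proof (cases "\<forall>k<j. P (suffix k w)")
      case True
      then show thesis
        using sat[of j] LeastI_ex[OF \<open>\<exists>j. Q (suffix j w)\<close>] by (simp add: j_def)
    next
      case False
      then show thesis
        using stop j by auto
    qed
  qed (use never in blast)
  then show "\<exists>n. \<forall>w'. fair E w' \<longrightarrow> (\<forall>i<n. w' i = w i) \<longrightarrow> ?U w' = ?U w"
  proof cases
    case (sat j)
    have U: "?U w'" if "Q (suffix j w') \<and> (\<forall>k<j. P (suffix k w'))" for w'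
      using that by blast
    have "prefix_determined E (\<lambda>w. Q (suffix j w) \<and> (\<forall>k<j. P (suffix k w)))"
      by (intro det_conj det_suffix det_All_less P Q)
    then show ?thesis
      by (rule det_transfer[OF _ w]) (use sat U in simp_all)
  next
    case (stop j)
    have U: "\<not> ?U w'" if "\<not> P (suffix j w') \<and> (\<forall>k<Suc j. \<not> Q (suffix k w'))" for w'
      using that by (metis not_less_eq)
    have "prefix_determined E (\<lambda>w. \<not> P (suffix j w) \<and> (\<forall>k<Suc j. \<not> Q (suffix k w)))"
      by (intro det_conj det_not[OF det_suffix] det_All_less det_not P Q)
    then show ?thesis
      by (rule det_transfer[OF _ w]) (use stop U[of w] in blast, use stop U[of w] U in metis)
  next
    case never
    obtain j where j: "w j \<in> forced E (\<lambda>w. \<not> Q w)"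
      using forced_recurrent[OF det_not[OF Q] w] never by blast
    have U: "\<not> ?U w'"
      if "fair E w'" "w' j \<in> forced E (\<lambda>w. \<not> Q w) \<and> (\<forall>k<j. \<not> Q (suffix k w'))" for w'
      using that forced_suffix[of E w' j "\<lambda>w. \<not> Q w"] by (metis not_less)
    have "prefix_determined E (\<lambda>w. w j \<in> forced E (\<lambda>w. \<not> Q w))"
      using det_suffix[OF det_state, of E "\<lambda>s. s \<in> forced E (\<lambda>w. \<not> Q w)" j] by simp
    then have "prefix_determined E (\<lambda>w. w j \<in> forced E (\<lambda>w. \<not> Q w) \<and> (\<forall>k<j. \<not> Q (suffix k w)))"
      by (intro det_conj det_All_less det_not Q)
    then show ?thesis
      by (rule det_transfer[OF _ w]) (use j never U in simp_all)
  qed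
qed

section \<open>The semantics in terms of suffixes\<close>

definition holds :: "('s \<Rightarrow> 'a set) \<Rightarrow> ('x \<Rightarrow> nat) \<Rightarrow> ('a, 'x) pltl \<Rightarrow> 's word \<Rightarrow> bool" where
  "holds L v \<phi> w \<longleftrightarrow> sat (\<lambda>i. L (w i)) 0 v \<phi>"

lemma ex_ge_nat: "(\<exists>j\<ge>i. P j) \<longleftrightarrow> (\<exists>j. P (i + j :: nat))"
  by (metis le_add1 le_iff_add)

lemma all_ge_nat: "(\<forall>j\<ge>i. P j) \<longleftrightarrow> (\<forall>j. P (i + j :: nat))"
  by (metis le_add1 le_iff_add)

lemma all_between_nat: "(\<forall>k. i \<le> k \<and> k < i + j \<longrightarrow> P k) \<longleftrightarrow> (\<forall>k<j. P (i + k :: nat))"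
  by (metis add_less_cancel_left le_add1 le_iff_add)

lemma ex_between_nat: "(\<exists>k. i \<le> k \<and> k < i + j \<and> P k) \<longleftrightarrow> (\<exists>k<j. P (i + k :: nat))"
  by (metis add_less_cancel_left le_add1 le_iff_add)

lemma all_between_le_nat: "(\<forall>k. i \<le> k \<and> k \<le> i + j \<longrightarrow> P k) \<longleftrightarrow> (\<forall>k\<le>j. P (i + k :: nat))"
  by (metis add_le_cancel_left le_add1 le_iff_add)

lemma ex_between_le_nat: "(\<exists>k. i \<le> k \<and> k \<le> i + j \<and> P k) \<longleftrightarrow> (\<exists>k\<le>j. P (i + k :: nat))"
  by (metis add_le_cancel_left le_add1 le_iff_add)

lemma sat_relative:
  "sat w i v (Until \<phi> \<psi>) \<longleftrightarrow> (\<exists>j. sat w (i + j) v \<psi> \<and> (\<forall>k<j. sat w (i + k) v \<phi>))"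
  "sat w i v (Release \<phi> \<psi>) \<longleftrightarrow> (\<forall>j. sat w (i + j) v \<psi> \<or> (\<exists>k<j. sat w (i + k) v \<phi>))"
  "sat w i v (Always \<phi>) \<longleftrightarrow> (\<forall>j. sat w (i + j) v \<phi>)"
  "sat w i v (EvVar x \<phi>) \<longleftrightarrow> (\<exists>j\<le>v x. sat w (i + j) v \<phi>)"
  "sat w i v (EvConst c \<phi>) \<longleftrightarrow> (\<exists>j\<le>c. sat w (i + j) v \<phi>)"
  "sat w i v (AlwConst c \<phi>) \<longleftrightarrow> (\<forall>j\<le>c. sat w (i + j) v \<phi>)"
  by (simp_all only: sat.simps ex_ge_nat all_between_nat)
    (simp_all only: all_ge_nat[of i] ex_between_nat all_between_le_nat ex_between_le_nat
      add_less_cancel_left add_le_cancel_left)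

lemma sat_suffix: "sat w (i + j) v \<phi> \<longleftrightarrow> sat (suffix i w) j v \<phi>"
proof (induction \<phi> arbitrary: j)
  case (Next \<phi>)
  then show ?case using Next[of "Suc j"] by simp
qed (simp_all add: sat_relative add.assoc del: sat.simps(6-11))

lemma holds_suffix: "holds L v \<phi> (suffix i w) \<longleftrightarrow> sat (\<lambda>i. L (w i)) i v \<phi>"
  using sat_suffix[of "\<lambda>i. L (w i)" i 0 v \<phi>] by (simp add: holds_def suffix_def)

lemma holds_simps:
  "holds L v (Prop a) w \<longleftrightarrow> a \<in> L (w 0)"
  "holds L v (NegProp a) w \<longleftrightarrow> a \<notin> L (w 0)"
  "holds L v (And \<phi> \<psi>) w \<longleftrightarrow> holds L v \<phi> w \<and> holds L v \<psi> w"
  "holds L v (Or \<phi> \<psi>) w \<longleftrightarrow> holds L v \<phi> w \<or> holds L v \<psi> w"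
  "holds L v (Next \<phi>) w \<longleftrightarrow> holds L v \<phi> (suffix 1 w)"
  "holds L v (Until \<phi> \<psi>) w \<longleftrightarrow> (\<exists>j. holds L v \<psi> (suffix j w) \<and> (\<forall>k<j. holds L v \<phi> (suffix k w)))"
  "holds L v (Release \<phi> \<psi>) w \<longleftrightarrow> (\<forall>j. holds L v \<psi> (suffix j w) \<or> (\<exists>k<j. holds L v \<phi> (suffix k w)))"
  "holds L v (Always \<phi>) w \<longleftrightarrow> (\<forall>j. holds L v \<phi> (suffix j w))"
  "holds L v (EvVar x \<phi>) w \<longleftrightarrow> (\<exists>j\<le>v x. holds L v \<phi> (suffix j w))"
  "holds L v (EvConst c \<phi>) w \<longleftrightarrow> (\<exists>j\<le>c. holds L v \<phi> (suffix j w))"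
  "holds L v (AlwConst c \<phi>) w \<longleftrightarrow> (\<forall>j\<le>c. holds L v \<phi> (suffix j w))"
  unfolding holds_suffix unfolding holds_def by (simp_all add: sat_relative del: sat.simps(6-11))

lemma det_holds:
  fixes E :: "'s :: finite \<Rightarrow> 's set"
  shows "prefix_determined E (holds L v \<phi>)"
proof (induction \<phi>)
  case (Release \<phi> \<psi>)
  then have "prefix_determined E (\<lambda>w. \<not> (\<exists>j. \<not> holds L v \<psi> (suffix j w) \<and> (\<forall>k<j. \<not> holds L v \<phi> (suffix k w))))"
    by (intro det_not det_until)
  then show ?case
    by (simp add: holds_simps[abs_def])
next
  case (Always \<phi>)
  then have "prefix_determined E (\<lambda>w. \<not> (\<exists>j. \<not> holds L v \<phi> (suffix j w) \<and> (\<forall>k<j. True)))"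
    by (intro det_not det_until det_state)
  then show ?case
    by (simp add: holds_simps[abs_def])
next
  case (Prop a)
  show ?case
    unfolding holds_simps[abs_def] by (rule det_state)
next
  case (NegProp a)
  show ?case
    unfolding holds_simps[abs_def] by (rule det_state)
next
  case (And \<phi> \<psi>)
  then show ?case
    unfolding holds_simps[abs_def] by (rule det_conj)
next
  case (Or \<phi> \<psi>)
  then show ?case
    unfolding holds_simps[abs_def] by (rule det_disj)
next
  case (Next \<phi>)
  then show ?case
    unfolding holds_simps[abs_def] by (rule det_suffix)
next
  case (Until \<phi> \<psi>)
  then show ?case
    unfolding holds_simps[abs_def] by (rule det_until)
next
  case (EvVar x \<phi>)
  then show ?case
    unfolding holds_simps[abs_def] less_Suc_eq_le[symmetric] by (rule det_Ex_less)
next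
  case (EvConst c \<phi>)
  then show ?case
    unfolding holds_simps[abs_def] less_Suc_eq_le[symmetric] by (rule det_Ex_less)
next
  case (AlwConst c \<phi>)
  then show ?case
    unfolding holds_simps[abs_def] less_Suc_eq_le[symmetric] by (rule det_All_less)
qed

section \<open>Finite witnesses of truth and falsity\<close>

primrec ev_within :: "nat \<Rightarrow> 's cosafe \<Rightarrow> 's cosafe" where
  "ev_within 0 f = f"
| "ev_within (Suc c) f = Disj f (Nxt (ev_within c f))"

primrec alw_within :: "nat \<Rightarrow> 's cosafe \<Rightarrow> 's cosafe" where
  "alw_within 0 f = f"
| "alw_within (Suc c) f = Conj f (Nxt (alw_within c f))"

lemma csat_ev_within: "csat (ev_within c f) xs \<longleftrightarrow> (\<exists>j\<le>c. csat f (drop j xs))"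
proof (induction c arbitrary: xs)
  case (Suc c)
  then show ?case
    by (simp add: Ex_less_Suc2 drop_Suc flip: less_Suc_eq_le)
qed simp

lemma csat_alw_within: "csat (alw_within c f) xs \<longleftrightarrow> (\<forall>j\<le>c. csat f (drop j xs))"
proof (induction c arbitrary: xs)
  case (Suc c)
  then show ?case
    by (simp add: All_less_Suc2 drop_Suc flip: less_Suc_eq_le)
qed simp

lemma card_insert_temporals: "finite A \<Longrightarrow> card (insert x A) \<le> Suc (card A)"
  by (simp add: card_insert_if)

text \<open>The expansion nests \<open>c\<close> operators \<open>Nxt\<close>, each giving at most
  one new temporal subformula. The summand \<open>c\<close> in \<open>len\<close> pays for
  them.\<close>

lemma card_temporals_within:
  "card (temporals (ev_within c f)) \<le> card (temporals f) + c"
  "card (temporals (alw_within c f)) \<le> card (temporals f) + c"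
proof -
  have "temporals (ev_within c f) \<subseteq> temporals f \<union> (\<lambda>k. Nxt (ev_within k f)) ` {..<c}"
    by (induction c) (auto simp: less_Suc_eq)
  then have "card (temporals (ev_within c f)) \<le> card (temporals f \<union> (\<lambda>k. Nxt (ev_within k f)) ` {..<c})"
    by (rule card_mono[rotated]) simp
  also have "\<dots> \<le> card (temporals f) + card ((\<lambda>k. Nxt (ev_within k f)) ` {..<c})"
    by (rule card_Un_le)
  also have "card ((\<lambda>k. Nxt (ev_within k f)) ` {..<c}) \<le> c"
    using card_image_le[of "{..<c}"] by simp
  finally show "card (temporals (ev_within c f)) \<le> card (temporals f) + c"
    by simp
  have "temporals (alw_within c f) \<subseteq> temporals f \<union> (\<lambda>k. Nxt (alw_within k f)) ` {..<c}"
    by (induction c) (auto simp: less_Suc_eq)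
  then have "card (temporals (alw_within c f)) \<le> card (temporals f \<union> (\<lambda>k. Nxt (alw_within k f)) ` {..<c})"
    by (rule card_mono[rotated]) simp
  also have "\<dots> \<le> card (temporals f) + card ((\<lambda>k. Nxt (alw_within k f)) ` {..<c})"
    by (rule card_Un_le)
  also have "card ((\<lambda>k. Nxt (alw_within k f)) ` {..<c}) \<le> c"
    using card_image_le[of "{..<c}"] by simp
  finally show "card (temporals (alw_within c f)) \<le> card (temporals f) + c"
    by simp
qed

text \<open>
  \<open>tr L G b \<phi>\<close> describes the finite words witnessing that \<open>\<phi>\<close> has truth value \<open>b\<close>, where
  \<open>G \<psi>\<close> is the set of states from which \<open>\<psi>\<close> has truth value \<open>b\<close> forever. For \<open>b = True\<close> the variable
  bounds are dropped: they hold automatically on words that are short enough.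
\<close>

primrec tr ::
    "('s \<Rightarrow> 'a set) \<Rightarrow> (('a, 'x) pltl \<Rightarrow> 's set) \<Rightarrow> bool \<Rightarrow> ('a, 'x) pltl \<Rightarrow> 's cosafe" where
  "tr L G b (Prop a) = Atom {s. (a \<in> L s) = b}"
| "tr L G b (NegProp a) = Atom {s. (a \<notin> L s) = b}"
| "tr L G b (And \<phi> \<psi>) = (if b then Conj (tr L G b \<phi>) (tr L G b \<psi>) else Disj (tr L G b \<phi>) (tr L G b \<psi>))"
| "tr L G b (Or \<phi> \<psi>) = (if b then Disj (tr L G b \<phi>) (tr L G b \<psi>) else Conj (tr L G b \<phi>) (tr L G b \<psi>))"
| "tr L G b (Next \<phi>) = Nxt (tr L G b \<phi>)"
| "tr L G b (Until \<phi> \<psi>) = (if b then Unt (tr L G b \<phi>) (tr L G b \<psi>)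
     else Unt (tr L G b \<psi>) (Disj (Conj (tr L G b \<phi>) (tr L G b \<psi>)) (Atom (G \<psi>))))"
| "tr L G b (Release \<phi> \<psi>) = (if b then Unt (tr L G b \<psi>) (Disj (Conj (tr L G b \<phi>) (tr L G b \<psi>)) (Atom (G \<psi>)))
     else Unt (tr L G b \<phi>) (tr L G b \<psi>))"
| "tr L G b (Always \<phi>) = (if b then Unt (tr L G b \<phi>) (Atom (G \<phi>)) else Unt (Atom UNIV) (tr L G b \<phi>))"
| "tr L G b (EvVar x \<phi>) = (if b then Unt (Atom UNIV) (tr L G b \<phi>) else Thru (tr L G b \<phi>))"
| "tr L G b (EvConst c \<phi>) = (if b then ev_within c (tr L G b \<phi>) else alw_within c (tr L G b \<phi>))"
| "tr L G b (AlwConst c \<phi>) = (if b then alw_within c (tr L G b \<phi>) else ev_within c (tr L G b \<phi>))"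

text \<open>Subformulas that the translation duplicates, as for release, count once because
  \<open>temporals\<close> is a set. Every leaf has length at least 1 and no temporal subformula;
  this spare symbol later yields a factor of 2 in the bound.\<close>

lemma card_temporals_tr: "Suc (card (temporals (tr L G b \<phi>))) \<le> len \<phi>"
proof (induction \<phi>)
  case (And \<phi> \<psi>)
  then show ?case
    using card_Un_le[of "temporals (tr L G b \<phi>)" "temporals (tr L G b \<psi>)"] by (cases b) simp_all
next
  case (Or \<phi> \<psi>)
  then show ?case
    using card_Un_le[of "temporals (tr L G b \<phi>)" "temporals (tr L G b \<psi>)"] by (cases b) simp_all
next
  case (Next \<phi>)
  then show ?case
    using card_insert_temporals[of "temporals (tr L G b \<phi>)" "Nxt (tr L G b \<phi>)"] by simp
next
  case (Until \<phi> \<psi>)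
  have "card (insert g (temporals (tr L G b \<phi>) \<union> temporals (tr L G b \<psi>))) < len (Until \<phi> \<psi>)" for g
    using Until card_Un_le[of "temporals (tr L G b \<phi>)" "temporals (tr L G b \<psi>)"]
      card_insert_temporals[of "temporals (tr L G b \<phi>) \<union> temporals (tr L G b \<psi>)" g] by simp
  then show ?case
    by (cases b) (simp_all add: Un_left_commute Un_commute Suc_le_eq)
next
  case (Release \<phi> \<psi>)
  have "card (insert g (temporals (tr L G b \<phi>) \<union> temporals (tr L G b \<psi>))) < len (Release \<phi> \<psi>)" for g
    using Release card_Un_le[of "temporals (tr L G b \<phi>)" "temporals (tr L G b \<psi>)"]
      card_insert_temporals[of "temporals (tr L G b \<phi>) \<union> temporals (tr L G b \<psi>)" g] by simp
  then show ?case
    by (cases b) (simp_all add: Un_left_commute Un_commute Suc_le_eq)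
next
  case (Always \<phi>)
  have "card (insert g (temporals (tr L G b \<phi>))) < len (Always \<phi>)" for g
    using Always card_insert_temporals[of "temporals (tr L G b \<phi>)" g] by simp
  then show ?case
    by (cases b) (simp_all add: Suc_le_eq)
next
  case (EvVar x \<phi>)
  have "card (insert g (temporals (tr L G b \<phi>))) < len (EvVar x \<phi>)" for g
    using EvVar card_insert_temporals[of "temporals (tr L G b \<phi>)" g] by simp
  then show ?case
    by (cases b) (simp_all add: Suc_le_eq)
next
  case (EvConst c \<phi>)
  then show ?case
    using card_temporals_within[of c "tr L G b \<phi>"] by (cases b) simp_all
next
  case (AlwConst c \<phi>)
  then show ?case
    using card_temporals_within[of c "tr L G b \<phi>"] by (cases b) simp_all
qed simp_all

section \<open>Completeness: truth values have finite witnesses\<close>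

lemma csat_subsequence_mono:
  assumes "csat f (subsequence W j m)" "m \<le> n"
  shows "csat f (subsequence W j n)"
proof -
  have "j < m"
    using assms(1) csat_Nil[of f] by (metis subsequence_empty not_le)
  then have "subsequence W j n = subsequence W j m @ subsequence W m n"
    using assms(2) using upt_add_eq_append[of j m "n - m"] \<open>j < m\<close>
    by (simp add: subsequence_def flip: map_append)
  then show ?thesis
    using assms(1) by (simp add: csat_append)
qed

text \<open>Finitely many witnesses with different ends can be prolonged to a common end beyond any
  given \<open>m\<close>, by monotonicity.\<close>

lemma csat_uniform:
  assumes "\<And>j. j < J \<Longrightarrow> \<exists>n. csat f (subsequence W j n)"
  shows "\<exists>n\<ge>m. \<forall>j<J. csat f (subsequence W j n)"
  using assms
proof (induction J)
  case (Suc J)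
  obtain n where n: "n \<ge> m" "\<forall>j<J. csat f (subsequence W j n)"
    using Suc by auto
  obtain n' where n': "csat f (subsequence W J n')"
    using Suc.prems by blast
  show ?case
  proof (intro exI[of _ "max n n'"] conjI allI impI)
    fix j
    assume "j < Suc J"
    then show "csat f (subsequence W j (max n n'))"
      using csat_subsequence_mono[OF n', of "max n n'"] csat_subsequence_mono[of f W j n "max n n'"] n(2)
      by (cases "j = J") auto
  qed (use n in simp)
qed auto

lemma csat_UntI:
  assumes "\<exists>n. csat g (subsequence W j n)" "\<And>k. k < j \<Longrightarrow> \<exists>n. csat f (subsequence W k n)"
  shows "\<exists>n. csat (Unt f g) (prefix n W)"
proof -
  obtain m where m: "csat g (subsequence W j m)"
    using assms(1) by blast
  obtain n where n: "n \<ge> m" "\<forall>k<j. csat f (subsequence W k n)"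
    using csat_uniform[of j f W m] assms(2) by blast
  have g: "csat g (subsequence W j n)"
    using csat_subsequence_mono[OF m n(1)] .
  then have "j < n"
    using csat_Nil[of g] by (metis subsequence_empty not_le)
  then show ?thesis
    using g n(2) by (intro exI[of _ n]) (auto simp: until_list_iff)
qed

lemma csat_forced:
  assumes "fst (W j) \<in> A"
  shows "\<exists>n. csat (Atom A) (subsequence W j n)"
  using assms by (intro exI[of _ "Suc j"]) simp

text \<open>A promise for all time becomes finite: it is checked up to a forced state, which exists
  by \<open>forced_recurrent\<close>. The target \<open>h\<close> is left open because that state is
  the whole target for \<open>Always\<close> and one disjunct of it for release.\<close>

lemma csat_foreverI:
  fixes W :: "('s :: finite \<times> bool) word"
  assumes "fair E (fst \<circ> W)" "prefix_determined E P" "\<And>j. P (suffix j (fst \<circ> W))"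
    and g: "\<And>j. P (suffix j (fst \<circ> W)) \<Longrightarrow> \<exists>n. csat g (subsequence W j n)"
    and h: "\<And>j n. csat (Atom (forced E P)) (subsequence W j n) \<Longrightarrow> csat h (subsequence W j n)"
  shows "\<exists>n. csat (Unt g h) (prefix n W)"
proof -
  obtain j where "fst (W j) \<in> forced E P"
    using forced_recurrent[OF assms(2,1,3)] by auto
  then show ?thesis
    using csat_forced[of W j] assms(3) by (intro csat_UntI[of _ _ j] g) (blast intro: h)+
qed

text \<open>Up to and including the first \<open>B\<close>, no earlier position can release the
  obligation, so \<open>A\<close> holds there. Without any \<open>B\<close>, it holds
  forever.\<close>

lemma release_cases:
  assumes "\<And>j :: nat. A j \<or> (\<exists>k<j. B k)"
  shows "(\<exists>j. B j \<and> (\<forall>k\<le>j. A k)) \<or> (\<forall>j. A j)"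
proof (cases "\<exists>j. B j")
  case True
  define j where "j = (LEAST j. B j)"
  have "B j" "\<And>k. k < j \<Longrightarrow> \<not> B k"
    using True by (auto simp: j_def intro: LeastI_ex dest: not_less_Least)
  then show ?thesis
    using assms by (metis order.strict_trans2)
qed (use assms in blast)

lemma csat_releaseI:
  fixes W :: "('s :: finite \<times> bool) word"
  assumes fair: "fair E (fst \<circ> W)" and det: "prefix_determined E P"
    and rel: "\<And>j. P (suffix j (fst \<circ> W)) \<or> (\<exists>k<j. R (suffix k (fst \<circ> W)))"
    and f: "\<And>j. R (suffix j (fst \<circ> W)) \<Longrightarrow> \<exists>n. csat f (subsequence W j n)"
    and g: "\<And>j. P (suffix j (fst \<circ> W)) \<Longrightarrow> \<exists>n. csat g (subsequence W j n)"
  shows "\<exists>n. csat (Unt g (Disj (Conj f g) (Atom (forced E P)))) (prefix n W)"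
  using release_cases[of "\<lambda>j. P (suffix j (fst \<circ> W))" "\<lambda>j. R (suffix j (fst \<circ> W))", OF rel]
proof
  assume "\<exists>j. R (suffix j (fst \<circ> W)) \<and> (\<forall>k\<le>j. P (suffix k (fst \<circ> W)))"
  then obtain j where j: "R (suffix j (fst \<circ> W))" "\<And>k. k \<le> j \<Longrightarrow> P (suffix k (fst \<circ> W))"
    by blast
  obtain m where m: "csat f (subsequence W j m)"
    using f[OF j(1)] by blast
  obtain n where n: "csat g (subsequence W j n)"
    using g[OF j(2)[OF order.refl]] by blast
  have "csat (Disj (Conj f g) (Atom (forced E P))) (subsequence W j (max m n))"
    using csat_subsequence_mono[OF m, of "max m n"] csat_subsequence_mono[OF n, of "max m n"] by simp
  then show ?thesis
    by (intro csat_UntI[of _ _ j] g exI) (use j(2) in auto)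
next
  assume "\<forall>j. P (suffix j (fst \<circ> W))"
  then show ?thesis
    by (intro csat_foreverI[OF fair det] g) auto
qed

text \<open>In negation normal form variables bound only eventualities and never occur under a
  negation, so larger values only help.\<close>

lemma sat_mono:
  "sat w i v \<phi> \<Longrightarrow> (\<And>x. x \<in> set2_pltl \<phi> \<Longrightarrow> v x \<le> v' x) \<Longrightarrow> sat w i v' \<phi>"
proof (induction \<phi> arbitrary: i)
  case (EvVar x \<phi>)
  then obtain j where "i \<le> j" "j \<le> i + v x" "sat w j v' \<phi>"
    by auto
  then show ?case
    using EvVar.prems(2)[of x] by (auto intro!: exI[of _ j])
qed (simp; blast)+

abbreviation always_forced ::
    "('s \<Rightarrow> 's set) \<Rightarrow> ('s \<Rightarrow> 'a set) \<Rightarrow> nat \<Rightarrow> bool \<Rightarrow> ('a, 'x) pltl \<Rightarrow> 's set" where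
  "always_forced E L k b \<phi> \<equiv> forced E (\<lambda>w. holds L (\<lambda>_. k) \<phi> w = b)"

lemma fst_comp_suffix: "fst \<circ> suffix j W = suffix j (fst \<circ> W)"
  by (simp add: fun_eq_iff)

lemma det_holds_eq:
  fixes E :: "'s :: finite \<Rightarrow> 's set"
  shows "prefix_determined E (\<lambda>w. holds L v \<phi> w = b)"
  using det_holds[of E L v \<phi>] det_not[OF det_holds[of E L v \<phi>]] by (cases b) simp_all

lemma tl_subsequence: "tl (subsequence W j n) = subsequence W (Suc j) n"
  by (simp add: subsequence_def map_tl[symmetric])

text \<open>The bound \<open>k\<close> enters the witness formula only through the forced sets. Two
  bounds therefore have the same witnesses as soon as the forced sets of the proper subformulas
  coincide.\<close>

abbreviation ctr where
  "ctr E L k b \<equiv> tr L (always_forced E L k b) b"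

text \<open>Every window of \<open>k + 1\<close> positions contains two marks. A subformula that
  fails for \<open>k\<close> further steps thus fails through two marks, as \<open>Thru\<close>
  demands.\<close>

definition dense :: "nat \<Rightarrow> ('s \<times> bool) word \<Rightarrow> bool" where
  "dense k W \<longleftrightarrow> (\<forall>i. \<exists>p q. i \<le> p \<and> p < q \<and> q \<le> i + k \<and> snd (W p) \<and> snd (W q))"

lemma dense_suffix:
  assumes "dense k W"
  shows "dense k (suffix j W)"
  unfolding dense_def
proof
  fix i
  obtain p q where "j + i \<le> p" "p < q" "q \<le> j + i + k" "snd (W p)" "snd (W q)"
    using assms unfolding dense_def by blast
  then show "\<exists>p q. i \<le> p \<and> p < q \<and> q \<le> i + k \<and> snd (suffix j W p) \<and> snd (suffix j W q)"
    by (intro exI[of _ "p - j"] exI[of _ "q - j"]) auto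
qed

lemma complete_suffix:
  assumes "fair E (fst \<circ> W)" "b \<or> dense k W"
    and "\<And>W. fair E (fst \<circ> W) \<Longrightarrow> holds L (\<lambda>_. k) \<phi> (fst \<circ> W) = b \<Longrightarrow> b \<or> dense k W \<Longrightarrow>
      \<exists>n. csat (ctr E L k b \<phi>) (prefix n W)"
    and "holds L (\<lambda>_. k) \<phi> (suffix j (fst \<circ> W)) = b"
  shows "\<exists>n. csat (ctr E L k b \<phi>) (subsequence W j n)"
proof -
  have "\<exists>n. csat (ctr E L k b \<phi>) (prefix n (suffix j W))"
    by (rule assms(3)) (use assms(1,2,4) fair_suffix[of E "fst \<circ> W" j] dense_suffix[of k W j] in \<open>auto simp only: fst_comp_suffix\<close>)
  then show ?thesis
    by auto
qed

text \<open>Eventualities point to a position and perpetual obligations to a forced state, so each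
  needs only finitely many witnesses of subformulas, which \<open>csat_uniform\<close> fits into one
  prefix.\<close>

lemma tr_complete:
  notes o_apply [simp del]
  fixes W :: "('s :: finite \<times> bool) word"
  assumes "fair E (fst \<circ> W)" "holds L (\<lambda>_. k) \<phi> (fst \<circ> W) = b" "b \<or> dense k W"
  shows "\<exists>n. csat (ctr E L k b \<phi>) (prefix n W)"
  using assms
proof (induction \<phi> arbitrary: W)
  case (Prop a)
  then show ?case
    by (intro exI[of _ 1]) (simp add: holds_simps o_apply)
next
  case (NegProp a)
  then show ?case
    by (intro exI[of _ 1]) (simp add: holds_simps o_apply)
next
  case (And \<phi> \<psi>)
  show ?case
  proof (cases b)
    case True
    then obtain m n where "csat (ctr E L k b \<phi>) (prefix m W)" "csat (ctr E L k b \<psi>) (prefix n W)"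
      using And.IH(1)[of W] And.IH(2)[of W] And.prems by (auto simp: holds_simps)
    then show ?thesis
      using True csat_subsequence_mono[of _ W 0 _ "max m n"] by (intro exI[of _ "max m n"]) auto
  next
    case False
    then show ?thesis
      using And.IH(1)[of W] And.IH(2)[of W] And.prems by (auto simp: holds_simps)
  qed
next
  case (Or \<phi> \<psi>)
  show ?case
  proof (cases b)
    case False
    then obtain m n where "csat (ctr E L k b \<phi>) (prefix m W)" "csat (ctr E L k b \<psi>) (prefix n W)"
      using Or.IH(1)[of W] Or.IH(2)[of W] Or.prems by (auto simp: holds_simps)
    then show ?thesis
      using False csat_subsequence_mono[of _ W 0 _ "max m n"] by (intro exI[of _ "max m n"]) auto
  next
    case True
    then show ?thesis
      using Or.IH(1)[of W] Or.IH(2)[of W] Or.prems by (auto simp: holds_simps)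
  qed
next
  case (Next \<phi>)
  have IH: "\<exists>n. csat (ctr E L k b \<phi>) (subsequence W j n)"
    if "holds L (\<lambda>_. k) \<phi> (suffix j (fst \<circ> W)) = b" for j
    using that by (rule complete_suffix[OF Next.prems(1,3), rotated]) (rule Next.IH)
  have "\<exists>n. csat (ctr E L k b \<phi>) (subsequence W 1 n)"
    by (rule IH) (use Next.prems(2) in \<open>simp only: holds_simps\<close>)
  then obtain n where "csat (ctr E L k b \<phi>) (subsequence W 1 n)"
    by blast
  then show ?case
    by (intro exI[of _ n]) (simp add: tl_subsequence)
next
  case (Until \<phi> \<psi>)
  have IH: "\<exists>n. csat (ctr E L k b \<phi>) (subsequence W j n)"
    if "holds L (\<lambda>_. k) \<phi> (suffix j (fst \<circ> W)) = b" for j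
    using that by (rule complete_suffix[OF Until.prems(1,3), rotated]) (rule Until.IH(1))
  have IH': "\<exists>n. csat (ctr E L k b \<psi>) (subsequence W j n)"
    if "holds L (\<lambda>_. k) \<psi> (suffix j (fst \<circ> W)) = b" for j
    using that by (rule complete_suffix[OF Until.prems(1,3), rotated]) (rule Until.IH(2))
  show ?case
  proof (cases b)
    case True
    then obtain j where j: "holds L (\<lambda>_. k) \<psi> (suffix j (fst \<circ> W))"
        "\<And>i. i < j \<Longrightarrow> holds L (\<lambda>_. k) \<phi> (suffix i (fst \<circ> W))"
      using Until.prems(2) by (auto simp: holds_simps)
    have "\<exists>n. csat (Unt (ctr E L k b \<phi>) (ctr E L k b \<psi>)) (prefix n W)"
      by (rule csat_UntI[of _ _ j], rule IH', use True j in simp, rule IH, use True j in simp)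
    then show ?thesis
      using True by simp
  next
    case False
    have "\<exists>n. csat (Unt (ctr E L k b \<psi>) (Disj (Conj (ctr E L k b \<phi>) (ctr E L k b \<psi>)) (Atom (always_forced E L k b \<psi>)))) (prefix n W)"
    proof (rule csat_releaseI[OF Until.prems(1) det_holds_eq, where R = "\<lambda>w. holds L (\<lambda>_. k) \<phi> w = b"])
      show "(holds L (\<lambda>_. k) \<psi> (suffix j (fst \<circ> W)) = b) \<or>
          (\<exists>i<j. (holds L (\<lambda>_. k) \<phi> (suffix i (fst \<circ> W)) = b))" for j
        using False Until.prems(2) by (auto simp: holds_simps)
    qed (fact IH IH')+
    then show ?thesis
      using False by simp
  qed
next
  case (Release \<phi> \<psi>)
  have IH: "\<exists>n. csat (ctr E L k b \<phi>) (subsequence W j n)"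
    if "holds L (\<lambda>_. k) \<phi> (suffix j (fst \<circ> W)) = b" for j
    using that by (rule complete_suffix[OF Release.prems(1,3), rotated]) (rule Release.IH(1))
  have IH': "\<exists>n. csat (ctr E L k b \<psi>) (subsequence W j n)"
    if "holds L (\<lambda>_. k) \<psi> (suffix j (fst \<circ> W)) = b" for j
    using that by (rule complete_suffix[OF Release.prems(1,3), rotated]) (rule Release.IH(2))
  show ?case
  proof (cases b)
    case False
    then obtain j where j: "\<not> holds L (\<lambda>_. k) \<psi> (suffix j (fst \<circ> W))"
        "\<And>i. i < j \<Longrightarrow> \<not> holds L (\<lambda>_. k) \<phi> (suffix i (fst \<circ> W))"
      using Release.prems(2) by (auto simp: holds_simps)
    have "\<exists>n. csat (Unt (ctr E L k b \<phi>) (ctr E L k b \<psi>)) (prefix n W)"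
      by (rule csat_UntI[of _ _ j], rule IH', use False j in simp, rule IH, use False j in simp)
    then show ?thesis
      using False by simp
  next
    case True
    have "\<exists>n. csat (Unt (ctr E L k b \<psi>) (Disj (Conj (ctr E L k b \<phi>) (ctr E L k b \<psi>)) (Atom (always_forced E L k b \<psi>)))) (prefix n W)"
    proof (rule csat_releaseI[OF Release.prems(1) det_holds_eq, where R = "\<lambda>w. holds L (\<lambda>_. k) \<phi> w = b"])
      show "(holds L (\<lambda>_. k) \<psi> (suffix j (fst \<circ> W)) = b) \<or>
          (\<exists>i<j. (holds L (\<lambda>_. k) \<phi> (suffix i (fst \<circ> W)) = b))" for j
        using True Release.prems(2) by (auto simp: holds_simps)
    qed (fact IH IH')+
    then show ?thesis
      using True by simp
  qed
next
  case (Always \<phi>)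
  have IH: "\<exists>n. csat (ctr E L k b \<phi>) (subsequence W j n)"
    if "holds L (\<lambda>_. k) \<phi> (suffix j (fst \<circ> W)) = b" for j
    using that by (rule complete_suffix[OF Always.prems(1,3), rotated]) (rule Always.IH)
  show ?case
  proof (cases b)
    case False
    then obtain j where j: "\<not> holds L (\<lambda>_. k) \<phi> (suffix j (fst \<circ> W))"
      using Always.prems(2) by (auto simp: holds_simps)
    have "\<exists>n. csat (Unt (Atom UNIV) (ctr E L k b \<phi>)) (prefix n W)"
      by (rule csat_UntI[of _ _ j], rule IH) (use False j in simp, rule csat_forced, simp)
    then show ?thesis
      using False by simp
  next
    case True
    have "\<exists>n. csat (Unt (ctr E L k b \<phi>) (Atom (always_forced E L k b \<phi>))) (prefix n W)"
      by (rule csat_foreverI[OF Always.prems(1) det_holds_eq[of E L "\<lambda>_. k" \<phi> b]])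
        (use True Always.prems(2) in \<open>simp add: holds_simps\<close>, rule IH)
    then show ?thesis
      using True by simp
  qed
next
  case (EvVar x \<phi>)
  have IH: "\<exists>n. csat (ctr E L k b \<phi>) (subsequence W j n)"
    if "holds L (\<lambda>_. k) \<phi> (suffix j (fst \<circ> W)) = b" for j
    using that by (rule complete_suffix[OF EvVar.prems(1,3), rotated]) (rule EvVar.IH)
  show ?case
  proof (cases b)
    case True
    then obtain j where j: "holds L (\<lambda>_. k) \<phi> (suffix j (fst \<circ> W))"
      using EvVar.prems(2) by (auto simp: holds_simps)
    have "\<exists>n. csat (Unt (Atom UNIV) (ctr E L k b \<phi>)) (prefix n W)"
      by (rule csat_UntI[of _ _ j], rule IH) (use True j in simp, rule csat_forced, simp)
    then show ?thesis
      using True by simp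
  next
    case False
    \<comment> \<open>The formula fails at all positions up to \<open>k\<close>, and density places
      two marks among them.\<close>
    then obtain p q where pq: "p < q" "q \<le> k" "snd (W p)" "snd (W q)"
      using EvVar.prems(3) unfolding dense_def by (metis add_0)
    have "\<exists>n. csat (ctr E L k b \<phi>) (subsequence W j n)" if "j < Suc k" for j
      by (rule IH) (use that False EvVar.prems(2) in \<open>simp add: holds_simps less_Suc_eq_le\<close>)
    \<comment> \<open>The end must lie beyond \<open>k\<close> so that the second mark is inside the
      prefix.\<close>
    then obtain n where n: "n \<ge> Suc k" "\<forall>j<Suc k. csat (ctr E L k b \<phi>) (subsequence W j n)"
      using csat_uniform[of "Suc k" "ctr E L k b \<phi>" W "Suc k"] by blast
    have "thru2 (csat (ctr E L k b \<phi>)) (prefix n W)"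
      by (rule thru2_I[OF pq(1)]) (use pq n in auto)
    then show ?thesis
      using False by auto
  qed
next
  case (EvConst c \<phi>)
  have IH: "\<exists>n. csat (ctr E L k b \<phi>) (subsequence W j n)"
    if "holds L (\<lambda>_. k) \<phi> (suffix j (fst \<circ> W)) = b" for j
    using that by (rule complete_suffix[OF EvConst.prems(1,3), rotated]) (rule EvConst.IH)
  show ?case
  proof (cases b)
    case True
    then obtain j where j: "j \<le> c" "holds L (\<lambda>_. k) \<phi> (suffix j (fst \<circ> W))"
      using EvConst.prems(2) by (auto simp: holds_simps)
    have "\<exists>n. csat (ctr E L k b \<phi>) (subsequence W j n)"
      by (rule IH) (use True j in auto)
    then show ?thesis
      using True j(1) by (auto simp: csat_ev_within)
  next
    case False
    have "\<exists>n. csat (ctr E L k b \<phi>) (subsequence W j n)" if "j < Suc c" for j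
      by (rule IH) (use that False EvConst.prems(2) in \<open>simp add: holds_simps less_Suc_eq_le\<close>)
    then obtain n where "\<forall>j<Suc c. csat (ctr E L k b \<phi>) (subsequence W j n)"
      using csat_uniform[of "Suc c" "ctr E L k b \<phi>" W] by blast
    then show ?thesis
      using False by (auto simp: csat_alw_within less_Suc_eq_le)
  qed
next
  case (AlwConst c \<phi>)
  have IH: "\<exists>n. csat (ctr E L k b \<phi>) (subsequence W j n)"
    if "holds L (\<lambda>_. k) \<phi> (suffix j (fst \<circ> W)) = b" for j
    using that by (rule complete_suffix[OF AlwConst.prems(1,3), rotated]) (rule AlwConst.IH)
  show ?case
  proof (cases b)
    case False
    then obtain j where j: "j \<le> c" "\<not> holds L (\<lambda>_. k) \<phi> (suffix j (fst \<circ> W))"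
      using AlwConst.prems(2) by (auto simp: holds_simps)
    have "\<exists>n. csat (ctr E L k b \<phi>) (subsequence W j n)"
      by (rule IH) (use False j in auto)
    then show ?thesis
      using False j(1) by (auto simp: csat_ev_within)
  next
    case True
    have "\<exists>n. csat (ctr E L k b \<phi>) (subsequence W j n)" if "j < Suc c" for j
      by (rule IH) (use that True AlwConst.prems(2) in \<open>simp add: holds_simps less_Suc_eq_le\<close>)
    then obtain n where "\<forall>j<Suc c. csat (ctr E L k b \<phi>) (subsequence W j n)"
      using csat_uniform[of "Suc c" "ctr E L k b \<phi>" W] by blast
    then show ?thesis
      using True by (auto simp: csat_alw_within less_Suc_eq_le)
  qed
qed

section \<open>Soundness: a witness fixes the truth value on every fair continuation\<close>

definition admissible :: "nat \<Rightarrow> bool \<Rightarrow> ('s \<times> bool) list \<Rightarrow> bool" where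
  "admissible k b xs \<longleftrightarrow> (if b then length xs \<le> Suc k else spaced k 0 xs)"

lemma admissible_drop: "admissible k b xs \<Longrightarrow> admissible k b (drop j xs)"
  by (auto simp: admissible_def intro: spaced_drop)

lemma csat_drop_less: "csat f (drop j xs) \<Longrightarrow> j < length xs"
  using csat_Nil[of f] by (metis drop_eq_Nil not_le)

lemma csat_UntE:
  assumes "csat (Unt f g) xs"
  obtains j where "csat g (drop j xs)" "\<forall>i<j. csat f (drop i xs)"
  using assms by (auto simp: until_list_iff)

lemma csat_Atom_drop:
  assumes "csat (Atom A) (drop j xs)"
  shows "(map fst xs \<frown> w) j \<in> A"
  using assms by (auto simp: hd_drop_conv_nth not_le)

text \<open>Before position \<open>j\<close> the witness vouches for \<open>P\<close>; from
  \<open>j\<close> on the forced state does, whatever fair continuation follows.\<close>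

lemma foreverD:
  assumes "fair E (map fst xs \<frown> w)" "csat (Unt g (Atom (forced E P))) xs"
    and g: "\<And>j. csat g (drop j xs) \<Longrightarrow> P (suffix j (map fst xs \<frown> w))"
  shows "P (suffix i (map fst xs \<frown> w))"
  using assms(2)
proof (rule csat_UntE)
  fix j
  assume j: "csat (Atom (forced E P)) (drop j xs)" "\<forall>i<j. csat g (drop i xs)"
  show ?thesis
    using forced_suffix[OF assms(1) csat_Atom_drop[OF j(1)], of i] g j(2)[rule_format, of i] leI[of i j] by blast
qed

lemma releaseD:
  assumes "fair E (map fst xs \<frown> w)"
    and "csat (Unt g (Disj (Conj f g) (Atom (forced E P)))) xs"
    and f: "\<And>j. csat f (drop j xs) \<Longrightarrow> R (suffix j (map fst xs \<frown> w))"
    and g: "\<And>j. csat g (drop j xs) \<Longrightarrow> P (suffix j (map fst xs \<frown> w))"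
  shows "P (suffix i (map fst xs \<frown> w)) \<or> (\<exists>k<i. R (suffix k (map fst xs \<frown> w)))"
  using assms(2)
proof (rule csat_UntE)
  fix j
  assume j: "csat (Disj (Conj f g) (Atom (forced E P))) (drop j xs)" "\<forall>i<j. csat g (drop i xs)"
  then consider "csat f (drop j xs)" "csat g (drop j xs)" | "csat (Atom (forced E P)) (drop j xs)"
    by auto
  then show ?thesis
  proof cases
    case 1
    then show ?thesis
      using f[of j] g[of i] j(2)[rule_format, of i] by (cases i j rule: linorder_cases) blast+
  next
    case 2
    then show ?thesis
      using forced_suffix[OF assms(1) csat_Atom_drop[OF 2], of i] g j(2)[rule_format, of i] leI[of i j] by blast
  qed
qed

lemma sound_suffix:
  assumes "fair E (map fst xs \<frown> w)" "admissible k b xs"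
    and "\<And>xs. csat (ctr E L k b \<phi>) xs \<Longrightarrow> fair E (map fst xs \<frown> w) \<Longrightarrow> admissible k b xs \<Longrightarrow>
      holds L (\<lambda>_. k) \<phi> (map fst xs \<frown> w) = b"
    and "csat (ctr E L k b \<phi>) (drop j xs)"
  shows "holds L (\<lambda>_. k) \<phi> (suffix j (map fst xs \<frown> w)) = b"
proof -
  have eq: "suffix j (map fst xs \<frown> w) = map fst (drop j xs) \<frown> w"
    using csat_drop_less[OF assms(4)] by (simp add: drop_map)
  show ?thesis
    unfolding eq
  proof (rule assms(3))
    show "fair E (map fst (drop j xs) \<frown> w)"
      using fair_suffix[OF assms(1), of j] by (simp only: eq)
  qed (use assms admissible_drop in blast)+
qed

text \<open>Only \<open>EvVar\<close> needs admissibility. For truth, positions in a word of length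
  at most \<open>Suc k\<close> are at most \<open>k\<close>, so the dropped bound is met. For
  falsity, marks more than \<open>k\<close> apart turn failure through two marks into failure for
  \<open>k\<close> steps.\<close>

lemma tr_sound:
  assumes "csat (ctr E L k b \<phi>) xs" "fair E (map fst xs \<frown> w)" "admissible k b xs"
  shows "holds L (\<lambda>_. k) \<phi> (map fst xs \<frown> w) = b"
  using assms
proof (induction \<phi> arbitrary: xs)
  case (Prop a)
  then show ?case
    using csat_Atom_drop[of _ 0 xs w] by (auto simp: holds_simps hd_conv_nth)
next
  case (NegProp a)
  then show ?case
    using csat_Atom_drop[of _ 0 xs w] by (auto simp: holds_simps hd_conv_nth)
next
  case (And \<phi> \<psi>)
  show ?case
    using And.prems And.IH[of xs] by (cases b) (auto simp: holds_simps)
next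
  case (Or \<phi> \<psi>)
  show ?case
    using Or.prems Or.IH[of xs] by (cases b) (auto simp: holds_simps)
next
  case (Next \<phi>)
  have "holds L (\<lambda>_. k) \<phi> (suffix 1 (map fst xs \<frown> w)) = b"
    using Next.prems(2,3) by (rule sound_suffix) (rule Next.IH, use Next.prems(1) in \<open>simp_all add: drop_Suc\<close>)
  then show ?case
    by (simp only: holds_simps)
next
  case (Until \<phi> \<psi>)
  let ?w = "map fst xs \<frown> w"
  have IH: "holds L (\<lambda>_. k) \<phi> (suffix j ?w) = b" if "csat (ctr E L k b \<phi>) (drop j xs)" for j
    using that by (rule sound_suffix[OF Until.prems(2,3), rotated]) (rule Until.IH(1))
  have IH': "holds L (\<lambda>_. k) \<psi> (suffix j ?w) = b" if "csat (ctr E L k b \<psi>) (drop j xs)" for j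
    using that by (rule sound_suffix[OF Until.prems(2,3), rotated]) (rule Until.IH(2))
  show ?case
  proof (cases b)
    case True
    then have "csat (Unt (ctr E L k b \<phi>) (ctr E L k b \<psi>)) xs"
      using Until.prems(1) by simp
    then obtain j where "csat (ctr E L k b \<psi>) (drop j xs)" "\<forall>i<j. csat (ctr E L k b \<phi>) (drop i xs)"
      by (rule csat_UntE) blast
    then show ?thesis
      using True IH IH' unfolding holds_simps by blast
  next
    case False
    have "csat (Unt (ctr E L k b \<psi>) (Disj (Conj (ctr E L k b \<phi>) (ctr E L k b \<psi>)) (Atom (always_forced E L k b \<psi>)))) xs"
      using False Until.prems(1) by simp
    from releaseD[OF Until.prems(2) this, where R = "\<lambda>w. holds L (\<lambda>_. k) \<phi> w = b"]
    have "(holds L (\<lambda>_. k) \<psi> (suffix i ?w) = b) \<or> (\<exists>j<i. holds L (\<lambda>_. k) \<phi> (suffix j ?w) = b)" for i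
      using IH IH' by blast
    then show ?thesis
      using False unfolding holds_simps by blast
  qed
next
  case (Release \<phi> \<psi>)
  let ?w = "map fst xs \<frown> w"
  have IH: "holds L (\<lambda>_. k) \<phi> (suffix j ?w) = b" if "csat (ctr E L k b \<phi>) (drop j xs)" for j
    using that by (rule sound_suffix[OF Release.prems(2,3), rotated]) (rule Release.IH(1))
  have IH': "holds L (\<lambda>_. k) \<psi> (suffix j ?w) = b" if "csat (ctr E L k b \<psi>) (drop j xs)" for j
    using that by (rule sound_suffix[OF Release.prems(2,3), rotated]) (rule Release.IH(2))
  show ?case
  proof (cases b)
    case False
    then have "csat (Unt (ctr E L k b \<phi>) (ctr E L k b \<psi>)) xs"
      using Release.prems(1) by simp
    then obtain j where "csat (ctr E L k b \<psi>) (drop j xs)" "\<forall>i<j. csat (ctr E L k b \<phi>) (drop i xs)"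
      by (rule csat_UntE) blast
    then show ?thesis
      using False IH IH' unfolding holds_simps by blast
  next
    case True
    have "csat (Unt (ctr E L k b \<psi>) (Disj (Conj (ctr E L k b \<phi>) (ctr E L k b \<psi>)) (Atom (always_forced E L k b \<psi>)))) xs"
      using True Release.prems(1) by simp
    from releaseD[OF Release.prems(2) this, where R = "\<lambda>w. holds L (\<lambda>_. k) \<phi> w = b"]
    have "(holds L (\<lambda>_. k) \<psi> (suffix i ?w) = b) \<or> (\<exists>j<i. holds L (\<lambda>_. k) \<phi> (suffix j ?w) = b)" for i
      using IH IH' by blast
    then show ?thesis
      using True unfolding holds_simps by blast
  qed
next
  case (Always \<phi>)
  let ?w = "map fst xs \<frown> w"
  have IH: "holds L (\<lambda>_. k) \<phi> (suffix j ?w) = b" if "csat (ctr E L k b \<phi>) (drop j xs)" for j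
    using that by (rule sound_suffix[OF Always.prems(2,3), rotated]) (rule Always.IH)
  show ?case
  proof (cases b)
    case False
    then have "csat (Unt (Atom UNIV) (ctr E L k b \<phi>)) xs"
      using Always.prems(1) by simp
    then obtain j where "csat (ctr E L k b \<phi>) (drop j xs)"
      by (rule csat_UntE) blast
    then show ?thesis
      using False IH unfolding holds_simps by blast
  next
    case True
    then have "csat (Unt (ctr E L k b \<phi>) (Atom (always_forced E L k b \<phi>))) xs"
      using Always.prems(1) by simp
    from foreverD[OF Always.prems(2) this] have "holds L (\<lambda>_. k) \<phi> (suffix i ?w) = b" for i
      using IH by blast
    then show ?thesis
      using True unfolding holds_simps by blast
  qed
next
  case (EvVar x \<phi>)
  let ?w = "map fst xs \<frown> w"
  have IH: "holds L (\<lambda>_. k) \<phi> (suffix j ?w) = b" if "csat (ctr E L k b \<phi>) (drop j xs)" for j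
    using that by (rule sound_suffix[OF EvVar.prems(2,3), rotated]) (rule EvVar.IH)
  show ?case
  proof (cases b)
    case True
    then have "csat (Unt (Atom UNIV) (ctr E L k b \<phi>)) xs"
      using EvVar.prems(1) by simp
    then obtain j where j: "csat (ctr E L k b \<phi>) (drop j xs)"
      by (rule csat_UntE) blast
    then have "j \<le> k"
      using csat_drop_less[OF j] EvVar.prems(3) True by (simp add: admissible_def)
    then show ?thesis
      using True IH[OF j] unfolding holds_simps by blast
  next
    case False
    then have "thru2 (csat (ctr E L k b \<phi>)) xs" "spaced k 0 xs"
      using EvVar.prems(1,3) by (simp_all add: admissible_def)
    then have "csat (ctr E L k b \<phi>) (drop j xs)" if "j \<le> k" for j
      using that thru2_spaced by blast
    then show ?thesis
      using False IH unfolding holds_simps by blast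
  qed
next
  case (EvConst c \<phi>)
  let ?w = "map fst xs \<frown> w"
  have IH: "holds L (\<lambda>_. k) \<phi> (suffix j ?w) = b" if "csat (ctr E L k b \<phi>) (drop j xs)" for j
    using that by (rule sound_suffix[OF EvConst.prems(2,3), rotated]) (rule EvConst.IH)
  show ?case
    using EvConst.prems(1) IH unfolding holds_simps
    by (cases b) (auto simp: csat_ev_within csat_alw_within)
next
  case (AlwConst c \<phi>)
  let ?w = "map fst xs \<frown> w"
  have IH: "holds L (\<lambda>_. k) \<phi> (suffix j ?w) = b" if "csat (ctr E L k b \<phi>) (drop j xs)" for j
    using that by (rule sound_suffix[OF AlwConst.prems(2,3), rotated]) (rule AlwConst.IH)
  show ?case
    using AlwConst.prems(1) IH unfolding holds_simps
    by (cases b) (auto simp: csat_ev_within csat_alw_within)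
qed

section \<open>Cutting and pumping witnesses\<close>

lemma short_witness:
  fixes f :: "'s :: finite cosafe"
  assumes "csat f (unmarked X)" "lpath E X" "hd X = s"
  shows "\<exists>Y. csat f (unmarked Y) \<and> lpath E Y \<and> hd Y = s \<and> length Y \<le> CARD('s) * 2 ^ card (temporals f)"
  using assms
proof (induction X rule: length_induct)
  case (1 X)
  show ?case
  proof (cases "length X \<le> CARD('s) * 2 ^ card (temporals f)")
    case False
    then have "CARD('s) * 2 ^ card (temporals f) < length X"
      by simp
    \<comment> \<open>Removing \<open>q\<close> gives a shorter path with the same first state and
      the same truth value. The word has no marks, so it is a single block with empty
      remainder.\<close>
    then obtain p q r where X: "X = p @ q @ r" and qr: "q \<noteq> []" "r \<noteq> []" "hd q = hd r"
      and eqv: "eqv f (unmarked (q @ r) @ []) (unmarked r @ [])"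
      by (rule repetition)
    have "eqv f (unmarked X) (unmarked (p @ r))"
      using eqv_append[OF eqv, of "unmarked p"] by (simp add: X)
    then have "csat f (unmarked (p @ r))"
      using 1(2) by (simp only: eqv_csat)
    moreover have "lpath E (p @ r)" "hd (p @ r) = s"
      using 1(3,4) qr by (auto simp: X successively_append_iff hd_append split: if_splits)
    moreover have "length (p @ r) < length X"
      using qr by (simp add: X)
    ultimately show ?thesis
      by (intro 1(1)[rule_format])
  next
    case True
    then show ?thesis
      using 1(2-4) by blast
  qed
qed

lemma lpath_pump:
  assumes "lpath E (p @ c @ r)" "c \<noteq> []" "r \<noteq> []" "hd c = hd r"
  shows "lpath E (p @ concat (replicate n c) @ r)" "hd (p @ concat (replicate n c) @ r) = hd (p @ c @ r)"
proof -
  have *: "lpath E (concat (replicate n c) @ r) \<and> hd (concat (replicate n c) @ r) = hd r"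
    using assms by (induction n) (auto simp: successively_append_iff hd_append)
  then show "lpath E (p @ concat (replicate n c) @ r)"
    using assms by (auto simp: successively_append_iff hd_append)
  show "hd (p @ concat (replicate n c) @ r) = hd (p @ c @ r)"
    using * assms by (auto simp: hd_append)
qed

lemma eqv_pump:
  assumes "eqv f (unmarked (c @ r) @ R) (unmarked r @ R)"
  shows "eqv f (unmarked (p @ c @ r) @ R) (unmarked (p @ concat (replicate n c) @ r) @ R)"
proof -
  have "eqv f (unmarked (concat (replicate n c) @ r) @ R) (unmarked r @ R)"
  proof (induction n)
    case (Suc n)
    have "eqv f (unmarked (concat (replicate (Suc n) c) @ r) @ R) (unmarked (c @ r) @ R)"
      using eqv_append[OF Suc, of "unmarked c"] by simp
    then show ?case
      using assms by (rule eqv_trans)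
  qed simp
  then have "eqv f (unmarked (c @ r) @ R) (unmarked (concat (replicate n c) @ r) @ R)"
    using eqv_trans[OF assms eqv_sym] by blast
  then show ?thesis
    using eqv_append[of f _ _ "unmarked p"] by simp
qed

text \<open>Each block consists of \<open>B - 1\<close> unmarked letters and a marked one, and is
  long enough to contain a repetition that can be iterated. The first state is kept so that
  consecutive blocks still fit together, and \<open>K\<close> unmarked letters come first so that a
  mark may precede.\<close>

lemma pump_blocks:
  fixes W :: "('s :: finite \<times> bool) word"
  assumes B: "CARD('s) * 2 ^ card (temporals f) + 2 \<le> B"
    and "\<And>n. (fst \<circ> W) (Suc n) \<in> E ((fst \<circ> W) n)" "\<And>i. snd (W i) \<longleftrightarrow> B dvd Suc i"
  shows "\<exists>Y. eqv f (prefix (q * B) W) Y \<and> lpath E (map fst Y) \<and> spaced K K Y \<and>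
    (q > 0 \<longrightarrow> Y \<noteq> [] \<and> fst (hd Y) = fst (W 0)) \<and> (q = 0 \<longrightarrow> Y = [])"
  using assms(2,3)
proof (induction q arbitrary: W)
  case (Suc q)
  define z where "z = prefix (B - 1) (fst \<circ> W)"
  define t where "t = fst (W (B - 1))"
  have Suc_B: "Suc (B - 1) = B"
    using B by simp
  \<comment> \<open>The blocks behind are pumped first, since the repetition in the first block has
    to be found relative to the word that finally follows it.\<close>
  have "\<exists>Y. eqv f (prefix (q * B) (suffix B W)) Y \<and> lpath E (map fst Y) \<and> spaced K K Y \<and>
      (q > 0 \<longrightarrow> Y \<noteq> [] \<and> fst (hd Y) = fst (suffix B W 0)) \<and> (q = 0 \<longrightarrow> Y = [])"
  proof (rule Suc.IH)
    show "(fst \<circ> suffix B W) (Suc n) \<in> E ((fst \<circ> suffix B W) n)" for n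
      using Suc.prems(1)[of "B + n"] by simp
    show "snd (suffix B W i) = (B dvd Suc i)" for i
      using Suc.prems(2)[of "B + i"] by (simp flip: add_Suc_right)
  qed
  then obtain Y where Y: "eqv f (prefix (q * B) (suffix B W)) Y" "lpath E (map fst Y)" "spaced K K Y"
      "q > 0 \<Longrightarrow> Y \<noteq> [] \<and> fst (hd Y) = fst (W B)" "q = 0 \<Longrightarrow> Y = []"
    by auto
  have "prefix (B - 1) W = unmarked z"
    using Suc.prems(2) by (auto simp: z_def subsequence_def unmarked_def prod_eq_iff dest: dvd_imp_le)
  moreover have "W (B - 1) = (t, True)"
    using Suc.prems(2)[of "B - 1"] Suc_B by (simp add: t_def prod_eq_iff)
  ultimately have "prefix B W = unmarked z @ [(t, True)]"
    using subseq_to_Suc[of 0 "B - 1" W] Suc_B by simp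
  then have W: "prefix (Suc q * B) W = unmarked z @ (t, True) # prefix (q * B) (suffix B W)"
    using subsequence_append[of W B "q * B"] by simp
  \<comment> \<open>Of the summand 2 in the bound on \<open>B\<close>, one letter is the mark and
    the other makes this inequality strict.\<close>
  have "CARD('s) * 2 ^ card (temporals f) < length z"
    using B by (simp add: z_def)
  then obtain p c r where z: "z = p @ c @ r" and cr: "c \<noteq> []" "r \<noteq> []" "hd c = hd r"
    and eqv: "eqv f (unmarked (c @ r) @ (t, True) # Y) (unmarked r @ (t, True) # Y)"
    by (rule repetition)
  \<comment> \<open>The cycle \<open>c\<close> is nonempty, so \<open>Suc K\<close> copies already
    give at least \<open>K\<close> unmarked letters.\<close>
  define z' where "z' = p @ concat (replicate (Suc K) c) @ r"
  have "eqv f (prefix (Suc q * B) W) (unmarked z @ (t, True) # Y)"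
    unfolding W by (intro eqv_append eqv_Cons Y)
  also have "eqv f (unmarked z @ (t, True) # Y) (unmarked z' @ (t, True) # Y)"
    unfolding z z'_def by (rule eqv_pump[OF eqv])
  finally (eqv_trans) have eqv': "eqv f (prefix (Suc q * B) W) (unmarked z' @ (t, True) # Y)" .
  have zt: "z @ [t] = prefix B (fst \<circ> W)"
    using subseq_to_Suc[of 0 "B - 1" "fst \<circ> W"] Suc_B by (simp add: z_def t_def)
  have "z \<noteq> []"
    using cr z by simp
  have "hd z = fst (W 0)"
    unfolding hd_conv_nth[OF \<open>z \<noteq> []\<close>] using B by (simp add: z_def)
  have "lpath E (z @ [t])"
    unfolding zt by (rule lpath_subsequence) (rule Suc.prems)
  moreover have "Y \<noteq> [] \<Longrightarrow> fst (hd Y) \<in> E t"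
    using Suc.prems(1)[of "B - 1"] Suc_B Y(4,5) by (cases "q = 0") (auto simp: t_def)
  ultimately have "lpath E (z @ t # map fst Y)"
    using Y(2) by (cases Y) (auto simp: successively_append_iff successively_Cons)
  then have "lpath E (p @ c @ r @ t # map fst Y)"
    by (simp add: z)
  then have path: "lpath E (z' @ t # map fst Y)" and hd: "hd (z' @ t # map fst Y) = hd z"
    using lpath_pump[of E p c "r @ t # map fst Y" "Suc K"] cr \<open>z \<noteq> []\<close> by (simp_all add: z'_def z hd_append)
  have "length c * Suc K \<ge> 1 * Suc K"
    using cr by (intro mult_le_mono1) (simp add: Suc_le_eq)
  then have "K \<le> length z'"
    by (simp add: z'_def length_concat sum_list_replicate algebra_simps)
  then have "spaced K K (unmarked z' @ (t, True) # Y)"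
    using Y(3) by (simp add: spaced_unmarked)
  moreover have "fst (hd (unmarked z' @ (t, True) # Y)) = fst (W 0)"
    using hd \<open>hd z = fst (W 0)\<close> by (cases z') auto
  ultimately show ?case
    using eqv' path by (intro exI[of _ "unmarked z' @ (t, True) # Y"]) simp
qed simp

lemma extend_to_fair:
  assumes fair_exists: "\<And>s. \<exists>w. fair E w \<and> w 0 = s" and "lpath E Y" "Y \<noteq> []"
  obtains w where "fair E (Y \<frown> w)"
proof -
  obtain w where w: "fair E w" "w 0 = last Y"
    using fair_exists by blast
  \<comment> \<open>The word \<open>w\<close> starts with the last letter of \<open>Y\<close>, which
    must not appear twice.\<close>
  have "fair E (butlast Y \<frown> w)"
    by (rule fair_conc) (use assms(2,3) w in simp_all)
  also have "w = [last Y] \<frown> suffix 1 w"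
    using w(2) by (metis One_nat_def build_cons build_first conc_empty)
  also have "butlast Y \<frown> [last Y] \<frown> suffix 1 w = Y \<frown> suffix 1 w"
    using assms(3) by (metis append_butlast_last_id conc_conc)
  finally show thesis
    by (rule that)
qed

section \<open>Changing the bound for a single formula\<close>

lemma holds_mono: "holds L (\<lambda>_. N) \<phi> w \<Longrightarrow> N \<le> K \<Longrightarrow> holds L (\<lambda>_. K) \<phi> w"
  unfolding holds_def by (erule sat_mono) simp

text \<open>A witness of truth under \<open>K\<close> is cut until its length is at most
  \<open>N\<close>. With equal witness formulas it can then be read as a witness under
  \<open>N\<close>, where the shortness guarantees every variable bound.\<close>

lemma cut_to_bound:
  fixes E :: "'s :: finite \<Rightarrow> 's set"
  assumes fair_exists: "\<And>s. \<exists>w. fair E w \<and> w 0 = s"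
    and ctr: "ctr E L K True \<phi> = ctr E L N True \<phi>"
    and N: "CARD('s) * 2 ^ card (temporals (ctr E L N True \<phi>)) \<le> N"
    and w: "fair E w" "holds L (\<lambda>_. K) \<phi> w"
  shows "\<exists>w'. fair E w' \<and> w' 0 = w 0 \<and> holds L (\<lambda>_. N) \<phi> w'"
proof -
  let ?f = "ctr E L N True \<phi>"
  let ?W = "\<lambda>i. (w i, False)"
  have W: "fst \<circ> ?W = w"
    by (simp add: fun_eq_iff)
  have "\<exists>n. csat (ctr E L K True \<phi>) (prefix n ?W)"
    by (rule tr_complete) (use w in \<open>simp_all add: W\<close>)
  then obtain n where "csat ?f (prefix n ?W)"
    unfolding ctr by blast
  moreover have "prefix n ?W = unmarked (prefix n w)"
    by (simp add: subsequence_def unmarked_def)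
  ultimately have n: "csat ?f (unmarked (prefix n w))"
    by simp
  then have "n > 0"
    using csat_Nil[of ?f] by (cases n) auto
  then have "hd (prefix n w) = w 0"
    by (simp add: hd_conv_nth)
  moreover have "lpath E (prefix n w)"
    by (rule lpath_subsequence) (rule fair_edge[OF w(1)])
  ultimately obtain Y where Y: "csat ?f (unmarked Y)" "lpath E Y" "hd Y = w 0"
      "length Y \<le> CARD('s) * 2 ^ card (temporals ?f)"
    using short_witness[OF n] by blast
  have "Y \<noteq> []"
    using Y(1) csat_Nil[of ?f] by auto
  obtain w' where w': "fair E (Y \<frown> w')"
    using extend_to_fair[OF fair_exists Y(2) \<open>Y \<noteq> []\<close>] .
  have "admissible N True (unmarked Y)"
    using Y(4) N by (simp add: admissible_def)
  then have "holds L (\<lambda>_. N) \<phi> (Y \<frown> w')"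
    using tr_sound[OF Y(1), of w'] w' by simp
  then show ?thesis
    using w' Y(3) \<open>Y \<noteq> []\<close> by (intro exI[of _ "Y \<frown> w'"]) (simp add: hd_conv_nth)
qed

lemma dense_periodic:
  assumes "0 < B" "2 * B \<le> Suc k"
  shows "dense k (\<lambda>i. (w i, B dvd Suc i))"
  unfolding dense_def
proof
  fix i
  \<comment> \<open>The last position of the block containing \<open>i\<close>; the next mark is at
    \<open>p + B\<close>, still inside the window.\<close>
  define p where "p = i div B * B + (B - 1)"
  have "i div B * B \<le> i" "i < i div B * B + B"
    using dividend_less_div_times[OF assms(1), of i] by simp_all
  then have "i \<le> p" "p + B \<le> i + k"
    unfolding p_def using assms by linarith+
  moreover have "Suc p = (i div B + 1) * B" "Suc (p + B) = (i div B + 2) * B"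
    using assms(1) by (simp_all add: p_def)
  then have "B dvd Suc p" "B dvd Suc (p + B)"
    by (metis dvd_triv_right)+
  ultimately show "\<exists>p q. i \<le> p \<and> p < q \<and> q \<le> i + k \<and> snd (w p, B dvd Suc p) \<and> snd (w q, B dvd Suc q)"
    using assms(1) by (intro exI[of _ p] exI[of _ "p + B"]) simp
qed

text \<open>Blocks of length at most half of \<open>Suc N\<close> make the marking dense for
  \<open>N\<close>, which yields a witness of falsity. Pumping spaces its marks for
  \<open>K\<close>, and the pumped word is a witness of falsity under \<open>K\<close>.\<close>

lemma pump_to_bound:
  fixes E :: "'s :: finite \<Rightarrow> 's set"
  assumes fair_exists: "\<And>s. \<exists>w. fair E w \<and> w 0 = s"
    and ctr: "ctr E L N False \<phi> = ctr E L K False \<phi>"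
    and N: "2 * (CARD('s) * 2 ^ card (temporals (ctr E L K False \<phi>)) + 2) \<le> Suc N"
    and w: "fair E w" "\<not> holds L (\<lambda>_. N) \<phi> w"
  shows "\<exists>w'. fair E w' \<and> w' 0 = w 0 \<and> \<not> holds L (\<lambda>_. K) \<phi> w'"
proof -
  let ?f = "ctr E L K False \<phi>"
  define B where "B = CARD('s) * 2 ^ card (temporals ?f) + 2"
  let ?W = "\<lambda>i. (w i, B dvd Suc i)"
  have W: "fst \<circ> ?W = w"
    by (simp add: fun_eq_iff)
  have "\<exists>n. csat (ctr E L N False \<phi>) (prefix n ?W)"
  proof (rule tr_complete)
    show "False \<or> dense N ?W"
      using dense_periodic[of B N w] N by (simp add: B_def)
  qed (use w in \<open>simp_all add: W\<close>)
  then obtain n where n: "csat ?f (prefix n ?W)"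
    unfolding ctr by blast
  \<comment> \<open>The witness is prolonged to a whole number of blocks, which monotonicity
    permits.\<close>
  have "n \<le> n * B"
    by (simp add: B_def)
  then have nB: "csat ?f (prefix (n * B) ?W)"
    using csat_subsequence_mono[OF n] by blast
  have "n > 0"
    using n csat_Nil[of ?f] by (cases n) auto
  have "\<exists>Y. eqv ?f (prefix (n * B) ?W) Y \<and> lpath E (map fst Y) \<and> spaced K K Y \<and>
    (n > 0 \<longrightarrow> Y \<noteq> [] \<and> fst (hd Y) = fst (?W 0)) \<and> (n = 0 \<longrightarrow> Y = [])"
    by (rule pump_blocks) (use fair_edge[OF w(1)] in \<open>simp_all add: W B_def\<close>)
  then obtain Y where Y: "eqv ?f (prefix (n * B) ?W) Y" "lpath E (map fst Y)" "spaced K K Y"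
      "Y \<noteq> []" "fst (hd Y) = w 0"
    using \<open>n > 0\<close> by auto
  have sat: "csat ?f Y"
    using nB eqv_csat[OF Y(1)] by simp
  obtain w' where w': "fair E (map fst Y \<frown> w')"
    using extend_to_fair[OF fair_exists Y(2)] Y(4) by blast
  have "admissible K False Y"
    using spaced_mono[OF Y(3)] by (simp add: admissible_def)
  then have "\<not> holds L (\<lambda>_. K) \<phi> (map fst Y \<frown> w')"
    using tr_sound[OF sat w'] by simp
  then show ?thesis
    using w' Y(4,5) by (intro exI[of _ "map fst Y \<frown> w'"]) (simp add: hd_conv_nth)
qed

text \<open>If a fair word from \<open>s\<close> violates \<open>P\<close> at position
  \<open>i\<close>, its tail from \<open>i\<close> on is exchanged for a fair word from the same
  state violating \<open>Q\<close>. The prefix is kept, so \<open>Q\<close> is not forced at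
  \<open>s\<close> either.\<close>

lemma forced_subset:
  assumes "\<And>w. fair E w \<Longrightarrow> \<not> P w \<Longrightarrow> \<exists>w'. fair E w' \<and> w' 0 = w 0 \<and> \<not> Q w'"
  shows "forced E Q \<subseteq> forced E P"
proof
  fix s
  assume s: "s \<in> forced E Q"
  have "P (suffix i w)" if w: "fair E w" "w 0 = s" for w i
  proof (rule ccontr)
    assume "\<not> P (suffix i w)"
    then obtain w' where w': "fair E w'" "w' 0 = w i" "\<not> Q w'"
      using assms[OF fair_suffix[OF w(1)], of i] by auto
    have "prefix i w @ [w i] = prefix (Suc i) w"
      by simp
    then have "lpath E (prefix i w @ [w' 0])"
      using lpath_subsequence[of w E 0 "Suc i", OF fair_edge[OF w(1)]] w'(2) by simp
    then have "fair E (prefix i w \<frown> w')"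
      by (rule fair_conc[OF w'(1)])
    moreover have "(prefix i w \<frown> w') 0 = s"
      using w(2) w'(2) by (cases i) (simp_all del: subseq_to_Suc)
    ultimately have "Q (suffix i (prefix i w \<frown> w'))"
      using s by (auto simp: forced_def simp del: suffix_conc_fst suffix_conc_snd)
    then show False
      using w'(3) suffix_conc_length[of "prefix i w" w'] by simp
  qed
  then show "s \<in> forced E P"
    by (simp add: forced_def)
qed

section \<open>Independence of the forced sets from the bound\<close>

context
  fixes E :: "'s :: finite \<Rightarrow> 's set" and L :: "'s \<Rightarrow> 'a set" and N K :: nat
  assumes fair_exists: "\<And>s. \<exists>w. fair E w \<and> w 0 = s"
    and N8: "8 \<le> N" and NK: "N \<le> K"
begin

text \<open>Monotonicity gives one direction for each truth value. The other is cutting from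
  \<open>K\<close> to \<open>N\<close> for truth and pumping from \<open>N\<close> to
  \<open>K\<close> for falsity; the word changes but its first state does not.\<close>

lemma exists_fair_holds_eq:
  assumes ctr: "\<And>b. ctr E L N b \<phi> = ctr E L K b \<phi>"
    and N: "2 * CARD('s) * 2 ^ len \<phi> \<le> N"
  shows "(\<exists>w. fair E w \<and> w 0 = s \<and> holds L (\<lambda>_. N) \<phi> w = b) \<longleftrightarrow>
    (\<exists>w. fair E w \<and> w 0 = s \<and> holds L (\<lambda>_. K) \<phi> w = b)"
proof -
  \<comment> \<open>The spare symbol of \<open>card_temporals_tr\<close> doubles the factor 2 of the
    assumption. Pumping takes half of this for the two blocks in a window, and the rest, with
    \<open>8 \<le> N\<close>, absorbs the two extra letters of each block.\<close>
  have bound: "4 * (CARD('s) * 2 ^ card (temporals (ctr E L k b \<phi>))) \<le> N" for k b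
  proof -
    have "(2 :: nat) ^ Suc (card (temporals (ctr E L k b \<phi>))) \<le> 2 ^ len \<phi>"
      by (rule power_increasing[OF card_temporals_tr]) simp
    then have "2 * CARD('s) * 2 ^ Suc (card (temporals (ctr E L k b \<phi>))) \<le> 2 * CARD('s) * 2 ^ len \<phi>"
      by (rule mult_le_mono2)
    also note N
    finally show ?thesis
      by (simp add: algebra_simps)
  qed
  show ?thesis
  proof (cases b)
    case True
    have "CARD('s) * 2 ^ card (temporals (ctr E L N True \<phi>)) \<le> N"
      using bound[of N True] by linarith
    note cut = cut_to_bound[OF fair_exists ctr[symmetric] this]
    have "(\<exists>w. fair E w \<and> w 0 = s \<and> holds L (\<lambda>_. N) \<phi> w) \<longleftrightarrow>
        (\<exists>w. fair E w \<and> w 0 = s \<and> holds L (\<lambda>_. K) \<phi> w)"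
      using cut holds_mono[OF _ NK] by blast
    then show ?thesis
      using True by simp
  next
    case False
    have "2 * (CARD('s) * 2 ^ card (temporals (ctr E L K False \<phi>)) + 2) \<le> Suc N"
    proof -
      have "2 * (x + 2) \<le> Suc N" if "4 * x \<le> N" for x
        using N8 that by simp
      then show ?thesis
        using bound by blast
    qed
    note pump = pump_to_bound[OF fair_exists ctr this]
    have "(\<exists>w. fair E w \<and> w 0 = s \<and> \<not> holds L (\<lambda>_. N) \<phi> w) \<longleftrightarrow>
        (\<exists>w. fair E w \<and> w 0 = s \<and> \<not> holds L (\<lambda>_. K) \<phi> w)"
      using pump holds_mono[OF _ NK] by blast
    then show ?thesis
      using False by simp
  qed
qed

text \<open>A state is forced to \<open>b\<close> when no fair word from it ever reaches a suffix of
  value \<open>\<not> b\<close>. Hence the witness formulas of the opposite truth value decide, and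
  the induction in \<open>ctr_eq\<close> runs over both values.\<close>

lemma always_forced_eq:
  assumes "\<And>b. ctr E L N b \<phi> = ctr E L K b \<phi>" "2 * CARD('s) * 2 ^ len \<phi> \<le> N"
  shows "always_forced E L N b \<phi> = always_forced E L K b \<phi>"
proof
  note eq = exists_fair_holds_eq[OF assms, of _ "\<not> b"]
  show "always_forced E L N b \<phi> \<subseteq> always_forced E L K b \<phi>"
    by (rule forced_subset) (use eq in blast)
  show "always_forced E L K b \<phi> \<subseteq> always_forced E L N b \<phi>"
    by (rule forced_subset) (use eq in blast)
qed

text \<open>The forced sets in the witness formula belong to proper subformulas, whose witness
  formulas agree by induction, so \<open>always_forced_eq\<close> applies to them.\<close>

lemma ctr_eq:
  assumes "2 * CARD('s) * 2 ^ len \<phi> \<le> N"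
  shows "ctr E L N b \<phi> = ctr E L K b \<phi>"
proof -
  have sub: "2 * CARD('s) * 2 ^ len \<psi> \<le> N"
    if "2 * CARD('s) * 2 ^ len \<phi> \<le> N" "len \<psi> \<le> len \<phi>" for \<phi> \<psi> :: "('a, 'x) pltl"
    using that order.trans[OF mult_le_mono2[OF power_increasing[OF that(2), of "2 :: nat"]] that(1)] by simp
  show ?thesis
    using assms
  proof (induction \<phi> arbitrary: b)
    case (And \<phi> \<psi>)
    have le: "2 * CARD('s) * 2 ^ len \<phi> \<le> N" "2 * CARD('s) * 2 ^ len \<psi> \<le> N"
      by (rule sub[OF And.prems], simp)+
    show ?case
      by (simp only: tr.simps And.IH(1)[OF le(1)] And.IH(2)[OF le(2)])
  next
    case (Or \<phi> \<psi>)
    have le: "2 * CARD('s) * 2 ^ len \<phi> \<le> N" "2 * CARD('s) * 2 ^ len \<psi> \<le> N"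
      by (rule sub[OF Or.prems], simp)+
    show ?case
      by (simp only: tr.simps Or.IH(1)[OF le(1)] Or.IH(2)[OF le(2)])
  next
    case (Next \<phi>)
    have le: "2 * CARD('s) * 2 ^ len \<phi> \<le> N"
      by (rule sub[OF Next.prems]) simp
    show ?case
      by (simp only: tr.simps Next.IH[OF le])
  next
    case (Until \<phi> \<psi>)
    have le: "2 * CARD('s) * 2 ^ len \<phi> \<le> N" "2 * CARD('s) * 2 ^ len \<psi> \<le> N"
      by (rule sub[OF Until.prems], simp)+
    show ?case
      by (simp only: tr.simps Until.IH(1)[OF le(1)] Until.IH(2)[OF le(2)]
          always_forced_eq[OF Until.IH(2)[OF le(2)] le(2)])
  next
    case (Release \<phi> \<psi>)
    have le: "2 * CARD('s) * 2 ^ len \<phi> \<le> N" "2 * CARD('s) * 2 ^ len \<psi> \<le> N"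
      by (rule sub[OF Release.prems], simp)+
    show ?case
      by (simp only: tr.simps Release.IH(1)[OF le(1)] Release.IH(2)[OF le(2)]
          always_forced_eq[OF Release.IH(2)[OF le(2)] le(2)])
  next
    case (Always \<phi>)
    have le: "2 * CARD('s) * 2 ^ len \<phi> \<le> N"
      by (rule sub[OF Always.prems]) simp
    show ?case
      by (simp only: tr.simps Always.IH[OF le] always_forced_eq[OF Always.IH[OF le] le])
  next
    case (EvVar x \<phi>)
    have le: "2 * CARD('s) * 2 ^ len \<phi> \<le> N"
      by (rule sub[OF EvVar.prems]) simp
    show ?case
      by (simp only: tr.simps EvVar.IH[OF le])
  next
    case (EvConst c \<phi>)
    have le: "2 * CARD('s) * 2 ^ len \<phi> \<le> N"
      by (rule sub[OF EvConst.prems]) simp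
    show ?case
      by (simp only: tr.simps EvConst.IH[OF le])
  next
    case (AlwConst c \<phi>)
    have le: "2 * CARD('s) * 2 ^ len \<phi> \<le> N"
      by (rule sub[OF AlwConst.prems]) simp
    show ?case
      by (simp only: tr.simps AlwConst.IH[OF le])
  qed (simp_all only: tr.simps)
qed

lemma all_fair_holds_decrease:
  assumes "2 * CARD('s) * 2 ^ len \<phi> \<le> N"
    and "\<And>w. fair E w \<Longrightarrow> w 0 = s \<Longrightarrow> holds L (\<lambda>_. K) \<phi> w"
    and "fair E w" "w 0 = s"
  shows "holds L (\<lambda>_. N) \<phi> w"
  using exists_fair_holds_eq[OF ctr_eq[OF assms(1)] assms(1), of s False] assms(2-4) by auto

end

section \<open>Almost all paths are fair\<close>

fun wt :: "('s \<Rightarrow> 's pmf) \<Rightarrow> 's list \<Rightarrow> real" where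
  "wt K [] = 1"
| "wt K [s] = 1"
| "wt K (s # t # u) = pmf (K s) t * wt K (t # u)"

lemma wt_nonneg: "0 \<le> wt K u"
  by (induction K u rule: wt.induct) auto

lemma wt_pos_iff: "0 < wt K u \<longleftrightarrow> lpath (\<lambda>s. set_pmf (K s)) u"
  using wt_nonneg[of K] by (induction K u rule: wt.induct) (auto simp: zero_less_mult_iff pmf_positive_iff order.order_iff_strict)

lemma wt_append: "c \<noteq> [] \<Longrightarrow> wt K (c @ p) = wt K c * wt K (last c # p)"
  by (induction K c rule: wt.induct) auto

lemma wt_prod: "wt K (s # u) = (\<Prod>i<length u. pmf (K ((s # u) ! i)) (u ! i))"
proof (induction u arbitrary: s)
  case (Cons t u)
  then show ?case
    by (simp add: prod.lessThan_Suc_shift del: prod.lessThan_Suc)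
qed simp

definition cyl :: "'s list \<Rightarrow> 's word set" where
  "cyl u = {\<omega>. prefix (length u) \<omega> = u}"

lemma cyl_eq: "cyl u = {\<omega>. \<forall>i<length u. \<omega> i = u ! i}"
  unfolding cyl_def by (subst list_eq_iff_nth_eq) simp

lemma measure_cyl:
  fixes M :: "('s :: finite, 'a) markov_chain"
  assumes "u \<noteq> []"
  shows "measure (path_measure M) (cyl u) = (if hd u = initial M then wt (transition M) u else 0)"
proof -
  obtain s u' where u: "u = s # u'"
    using assms by (cases u) auto
  have "cyl u = {\<omega>. \<forall>i\<le>length u'. \<omega> i = u ! i}"
    by (simp add: cyl_eq u less_Suc_eq_le)
  then show ?thesis
    using emeasure_cylinder[of M "length u'" "\<lambda>i. u ! i"]
    by (simp add: measure_def u wt_prod prod_ennreal prod_nonneg)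
qed

lemma cyl_sets [measurable]: "cyl u \<in> sets (path_measure M)"
proof -
  have "{\<omega> \<in> space (path_measure M). \<forall>i\<in>{..<length u}. \<omega> i = u ! i} \<in> sets (path_measure M)"
  proof (rule sets.sets_Collect_finite_All)
    fix i
    have "(\<lambda>\<omega>. \<omega> i) \<in> measurable (path_measure M) (count_space UNIV)"
      unfolding measurable_cong_sets[OF sets_path_measure refl]
      by (rule measurable_component_singleton) simp
    then have "(\<lambda>\<omega>. \<omega> i) -` {u ! i} \<inter> space (path_measure M) \<in> sets (path_measure M)"
      by (rule measurable_sets) simp
    moreover have "(\<lambda>\<omega>. \<omega> i) -` {u ! i} \<inter> space (path_measure M) = {\<omega> \<in> space (path_measure M). \<omega> i = u ! i}"
      by auto
    ultimately show "{\<omega> \<in> space (path_measure M). \<omega> i = u ! i} \<in> sets (path_measure M)"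
      by simp
  qed simp
  moreover have "cyl u = {\<omega> \<in> space (path_measure M). \<forall>i\<in>{..<length u}. \<omega> i = u ! i}"
    by (simp add: cyl_eq Ball_def)
  ultimately show ?thesis
    by simp
qed

lemma cyl_append_subset: "cyl (c @ p) \<subseteq> cyl c"
  by (auto simp: cyl_eq nth_append)

lemma cyl_disjoint: "length c = length d \<Longrightarrow> c \<noteq> d \<Longrightarrow> cyl c \<inter> cyl d = {}"
  by (auto simp: cyl_def)

lemma measure_cyl_append:
  fixes M :: "('s :: finite, 'a) markov_chain"
  assumes "c \<noteq> []"
  shows "measure (path_measure M) (cyl (c @ p))
    = measure (path_measure M) (cyl c) * wt (transition M) (last c # p)"
  using assms by (simp add: measure_cyl wt_append)

text \<open>From every alive word longer than \<open>n\<close> there is, within \<open>l\<close>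
  further steps, a chance of at least \<open>\<epsilon>\<close> to die. The probability of being
  alive therefore shrinks by the factor \<open>1 - \<epsilon>\<close> every \<open>l\<close> steps
  and tends to 0.\<close>

lemma AE_escape:
  fixes M :: "('s :: finite, 'a) markov_chain"
  assumes eps: "0 < \<epsilon>" "\<epsilon> \<le> 1"
    and closed: "\<And>c d. alive (c @ d) \<Longrightarrow> alive c"
    and ext: "\<And>c. alive c \<Longrightarrow> n < length c \<Longrightarrow>
      \<exists>p. length p \<le> l \<and> \<epsilon> \<le> wt (transition M) (last c # p) \<and> \<not> alive (c @ p)"
  shows "AE \<omega> in path_measure M. \<exists>m. \<not> alive (prefix m \<omega>)"
proof -
  interpret prob_space "path_measure M"
    by (rule prob_space_path_measure)
  define A where "A j = {c. length c = Suc n + j * l \<and> alive c}" for j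
  define U where "U j = (\<Union>c\<in>A j. cyl c)" for j
  have fin: "finite (A j)" for j
    using finite_lists_length_eq[of "UNIV :: 's set" "Suc n + j * l"]
    by (rule finite_subset[rotated]) (auto simp: A_def)
  have U_sets: "U j \<in> events" for j
    unfolding U_def using fin by (intro sets.finite_UN) auto
  have U: "prob (U j) = (\<Sum>c\<in>A j. prob (cyl c))" for j
    unfolding U_def
    by (intro finite_measure_finite_Union fin) (auto simp add: A_def disjoint_family_on_def cyl_disjoint)
  have step: "prob (U (Suc j)) \<le> (1 - \<epsilon>) * prob (U j)" for j
  proof -
    have "\<forall>c\<in>A j. \<exists>p. length p \<le> l \<and> \<epsilon> \<le> wt (transition M) (last c # p) \<and> \<not> alive (c @ p)"
      using ext by (auto simp: A_def)
    then obtain p where p: "\<And>c. c \<in> A j \<Longrightarrow> length (p c) \<le> l"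
        "\<And>c. c \<in> A j \<Longrightarrow> \<epsilon> \<le> wt (transition M) (last c # p c)" "\<And>c. c \<in> A j \<Longrightarrow> \<not> alive (c @ p c)"
      by metis
    \<comment> \<open>All prefixes of an alive word are alive. As \<open>p c\<close> has length at
      most \<open>l\<close>, a path alive at stage \<open>Suc j\<close> cannot have followed the
      fatal extension of its prefix \<open>c\<close>.\<close>
    have "U (Suc j) \<subseteq> (\<Union>c\<in>A j. cyl c - cyl (c @ p c))"
    proof
      fix \<omega>
      assume "\<omega> \<in> U (Suc j)"
      then have alive: "alive (prefix (Suc n + Suc j * l) \<omega>)"
        by (auto simp: U_def A_def cyl_def simp del: subseq_to_Suc)
      let ?c = "prefix (Suc n + j * l) \<omega>"
      have alive': "alive (prefix m \<omega>)" if "m \<le> Suc n + Suc j * l" for m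
        using closed[of "prefix m \<omega>" "subsequence \<omega> m (Suc n + Suc j * l)"] alive that
          subsequence_append[of \<omega> m "Suc n + Suc j * l - m"] by (simp del: subseq_to_Suc)
      then have c: "?c \<in> A j"
        by (simp add: A_def del: subseq_to_Suc)
      have "\<omega> \<notin> cyl (?c @ p ?c)"
      proof
        assume "\<omega> \<in> cyl (?c @ p ?c)"
        then have "prefix (Suc n + j * l + length (p ?c)) \<omega> = ?c @ p ?c"
          by (simp add: cyl_def del: subseq_to_Suc)
        then show False
          using alive'[of "Suc n + j * l + length (p ?c)"] p(1,3)[OF c] by (simp del: subseq_to_Suc)
      qed
      moreover have "\<omega> \<in> cyl ?c"
        by (simp add: cyl_def del: subseq_to_Suc)
      ultimately show "\<omega> \<in> (\<Union>c\<in>A j. cyl c - cyl (c @ p c))"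
        using c by blast
    qed
    then have "prob (U (Suc j)) \<le> prob (\<Union>c\<in>A j. cyl c - cyl (c @ p c))"
      using fin by (intro finite_measure_mono sets.finite_UN) auto
    also have "\<dots> \<le> (\<Sum>c\<in>A j. prob (cyl c - cyl (c @ p c)))"
      using fin by (intro finite_measure_subadditive_finite) auto
    also have "\<dots> \<le> (\<Sum>c\<in>A j. (1 - \<epsilon>) * prob (cyl c))"
    proof (rule sum_mono)
      fix c
      assume c: "c \<in> A j"
      then have "c \<noteq> []"
        by (auto simp: A_def)
      have "prob (cyl c - cyl (c @ p c)) = prob (cyl c) - prob (cyl c) * wt (transition M) (last c # p c)"
        using finite_measure_Diff[OF cyl_sets cyl_sets cyl_append_subset, of c "p c"]
          measure_cyl_append[OF \<open>c \<noteq> []\<close>, of M "p c"] by simp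
      also have "\<dots> \<le> prob (cyl c) - prob (cyl c) * \<epsilon>"
        using p(2)[OF c] by (intro diff_left_mono mult_left_mono) auto
      finally show "prob (cyl c - cyl (c @ p c)) \<le> (1 - \<epsilon>) * prob (cyl c)"
        by (simp add: algebra_simps)
    qed
    finally show ?thesis
      by (simp add: U sum_distrib_left)
  qed
  have le: "prob (U j) \<le> (1 - \<epsilon>) ^ j" for j
  proof (induction j)
    case (Suc j)
    show ?case
      using order.trans[OF step mult_left_mono[OF Suc, of "1 - \<epsilon>"]] eps by simp
  qed simp
  have N_sets: "(\<Inter>j. U j) \<in> events"
    using U_sets by (intro sets.countable_INT) auto
  have "prob (\<Inter>j. U j) \<le> (1 - \<epsilon>) ^ j" for j
    using finite_measure_mono[of "\<Inter>j. U j" "U j"] U_sets le[of j] by (meson INF_lower UNIV_I order.trans)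
  moreover have "(\<lambda>j. (1 - \<epsilon>) ^ j) \<longlonglongrightarrow> 0"
    using eps by (intro LIMSEQ_power_zero) simp
  ultimately have "prob (\<Inter>j. U j) \<le> 0"
    by (intro LIMSEQ_le_const) auto
  then have "(\<Inter>j. U j) \<in> null_sets (path_measure M)"
    using N_sets by (intro null_setsI) (simp_all add: emeasure_eq_measure measure_le_0_iff)
  moreover have "{\<omega> \<in> space (path_measure M). \<not> (\<exists>m. \<not> alive (prefix m \<omega>))} \<subseteq> (\<Inter>j. U j)"
    by (auto simp: U_def A_def cyl_def simp del: subseq_to_Suc)
  ultimately show ?thesis
    by (rule AE_I')
qed

text \<open>There are only countably many finite words that start wrongly or use an impossible step,
  and each has a null cylinder.\<close>

lemma AE_path:
  fixes M :: "('s :: finite, 'a) markov_chain"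
  shows "AE \<omega> in path_measure M. \<omega> 0 = initial M \<and> (\<forall>n. \<omega> (Suc n) \<in> set_pmf (transition M (\<omega> n)))"
proof -
  interpret prob_space "path_measure M"
    by (rule prob_space_path_measure)
  let ?E = "\<lambda>s. set_pmf (transition M s)"
  define bad where "bad = {c. c \<noteq> [] \<and> \<not> (hd c = initial M \<and> lpath ?E c)}"
  have "countable bad"
    using countable_lists[of "UNIV :: 's set"] by (rule countable_subset[rotated]) (auto simp: lists_UNIV)
  moreover have "AE \<omega> in path_measure M. \<omega> \<notin> cyl c" if c: "c \<in> bad" for c
  proof (rule AE_not_in)
    have "wt (transition M) c = 0" if "hd c = initial M"
      using c that wt_pos_iff[of "transition M" c] wt_nonneg[of "transition M" c] by (auto simp: bad_def)
    then have "prob (cyl c) = 0"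
      using c by (auto simp: bad_def measure_cyl)
    then show "cyl c \<in> null_sets (path_measure M)"
      by (intro null_setsI) (simp_all add: emeasure_eq_measure)
  qed
  ultimately have "AE \<omega> in path_measure M. \<forall>c\<in>bad. \<omega> \<notin> cyl c"
    by (simp add: AE_ball_countable)
  then show ?thesis
  proof eventually_elim
    case (elim \<omega>)
    have good: "hd (prefix (Suc n) \<omega>) = initial M \<and> lpath ?E (prefix (Suc n) \<omega>)" for n
    proof -
      have "\<omega> \<in> cyl (prefix (Suc n) \<omega>)"
        by (simp add: cyl_def del: subseq_to_Suc)
      then have "prefix (Suc n) \<omega> \<notin> bad"
        using elim by blast
      then show ?thesis
        by (simp add: bad_def del: subseq_to_Suc)
    qed
    have "\<omega> (Suc n) \<in> ?E (\<omega> n)" for n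
      using good[of "Suc n"] by (simp add: successively_append_iff)
    then show ?case
      using good[of 0] by simp
  qed
qed

text \<open>\<open>R u\<close> holds the states from which the start of \<open>u\<close> can be
  reached. For each of countably many \<open>u\<close> and \<open>n\<close>, a path that stays in
  \<open>R u\<close> from time \<open>n\<close> on almost surely traverses \<open>u\<close> after
  \<open>n\<close>. If the first state of \<open>u\<close> recurs, the path lies in
  \<open>R u\<close> at all times.\<close>

lemma AE_fair:
  fixes M :: "('s :: finite, 'a) markov_chain"
  shows "AE \<omega> in path_measure M. fair (\<lambda>s. set_pmf (transition M s)) \<omega> \<and> \<omega> 0 = initial M"
proof -
  let ?E = "\<lambda>s. set_pmf (transition M s)"
  define R where "R u = {t. \<exists>p. lpath ?E (t # p) \<and> last (t # p) = hd u}" for u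
  have "AE \<omega> in path_measure M. \<exists>i\<ge>n. \<omega> i \<notin> R u \<or> subsequence \<omega> i (i + length u) = u"
    if u: "u \<noteq> []" "lpath ?E u" for u n
  proof -
    have "\<forall>t\<in>R u. \<exists>p. lpath ?E (t # p) \<and> last (t # p) = hd u"
      by (simp add: R_def)
    then obtain p where p: "\<And>t. t \<in> R u \<Longrightarrow> lpath ?E (t # p t)" "\<And>t. t \<in> R u \<Longrightarrow> last (t # p t) = hd u"
      by metis
    \<comment> \<open>Walk to the start of \<open>u\<close>, then along \<open>u\<close>; the first
      letter of \<open>u\<close> is already the last one of \<open>t # p t\<close>.\<close>
    define q where "q t = p t @ tl u" for t
    have split: "t # q t = butlast (t # p t) @ u" if "t \<in> R u" for t
      using append_butlast_last_id[of "t # p t"] p(2)[OF that] u(1)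
      by (metis append.assoc append_Cons append_Nil list.collapse list.discI q_def)
    have q: "lpath ?E (t # q t)" if "t \<in> R u" for t
    proof -
      have "lpath ?E ((t # p t) @ tl u)"
        using p[OF that] u by (cases u) (auto simp: successively_append_iff successively_Cons simp del: last.simps append_Cons)
      then show ?thesis
        by (simp add: q_def)
    qed
    \<comment> \<open>There are finitely many states, so a single positive chance and a single
      length serve all of them. The inserted 1 gives \<open>\<epsilon> \<le> 1\<close> at
      once.\<close>
    define \<epsilon> where "\<epsilon> = Min (insert 1 ((\<lambda>t. wt (transition M) (t # q t)) ` R u))"
    define l where "l = Max (insert 0 ((\<lambda>t. length (q t)) ` R u))"
    define alive where "alive c \<longleftrightarrow> (\<forall>i<length c. n \<le> i \<longrightarrow> c ! i \<in> R u) \<and>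
      (\<forall>i\<ge>n. i + length u \<le> length c \<longrightarrow> take (length u) (drop i c) \<noteq> u)" for c
    have "AE \<omega> in path_measure M. \<exists>m. \<not> alive (prefix m \<omega>)"
    proof (rule AE_escape)
      show "0 < \<epsilon>" "\<epsilon> \<le> 1"
        using q by (auto simp: \<epsilon>_def wt_pos_iff)
      show "alive c" if "alive (c @ d)" for c d
        unfolding alive_def
      proof (intro conjI allI impI)
        fix i
        assume "i < length c" "n \<le> i"
        then show "c ! i \<in> R u"
          using that by (auto simp: alive_def nth_append dest!: spec[of _ i])
      next
        fix i
        assume "n \<le> i" "i + length u \<le> length c"
        then have "take (length u) (drop i (c @ d)) = take (length u) (drop i c)"
          by simp
        then show "take (length u) (drop i c) \<noteq> u"
          using that \<open>n \<le> i\<close> \<open>i + length u \<le> length c\<close> unfolding alive_def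
          by (metis length_append trans_le_add1)
      qed
      fix c
      assume c: "alive c" "n < length c"
      let ?t = "last c"
      have "c \<noteq> []"
        using c by auto
      then have t: "?t \<in> R u"
        using c by (auto simp: alive_def last_conv_nth)
      have "\<not> alive (c @ q ?t)"
      proof
        \<comment> \<open>The position where \<open>u\<close> starts. It may overlap the last letter
          of \<open>c\<close>, which is why \<open>c\<close> has to be longer than
          \<open>n\<close>.\<close>
        let ?i = "length (butlast c @ butlast (?t # p ?t))"
        assume alive: "alive (c @ q ?t)"
        have "c @ q ?t = butlast c @ ?t # q ?t"
          using \<open>c \<noteq> []\<close> by (metis append.assoc append_Cons append_Nil append_butlast_last_id)
        also have "\<dots> = (butlast c @ butlast (?t # p ?t)) @ u"
          unfolding split[OF t] by simp
        finally have "drop ?i (c @ q ?t) = u" "length (c @ q ?t) = ?i + length u"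
          by (simp_all del: butlast.simps)
        moreover have "n \<le> ?i"
          using c(2) by simp
        ultimately show False
          using alive unfolding alive_def by (metis order.refl take_all)
      qed
      then show "\<exists>p. length p \<le> l \<and> \<epsilon> \<le> wt (transition M) (last c # p) \<and> \<not> alive (c @ p)"
        using t by (intro exI[of _ "q ?t"]) (auto simp: l_def \<epsilon>_def)
    qed
    then show ?thesis
    proof eventually_elim
      case (elim \<omega>)
      then obtain m where "\<not> alive (prefix m \<omega>)"
        by blast
      then consider i where "i < m" "n \<le> i" "\<omega> i \<notin> R u"
        | i where "n \<le> i" "i + length u \<le> m" "take (length u) (drop i (prefix m \<omega>)) = u"
        unfolding alive_def by auto
      then show ?case
      proof cases
        case 2
        then show ?thesis
          by (intro exI[of _ i]) (simp add: min_def split: if_splits)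
      qed blast
    qed
  qed
  then have "AE \<omega> in path_measure M. \<forall>n. \<exists>i\<ge>n. \<omega> i \<notin> R u \<or> subsequence \<omega> i (i + length u) = u"
    if "u \<noteq> []" "lpath ?E u" for u
    using that by (simp add: AE_all_countable)
  then have "\<forall>u\<in>{u. u \<noteq> [] \<and> lpath ?E u}. AE \<omega> in path_measure M.
      \<forall>n. \<exists>i\<ge>n. \<omega> i \<notin> R u \<or> subsequence \<omega> i (i + length u) = u"
    by blast
  moreover have "countable {u. u \<noteq> [] \<and> lpath ?E u}"
    using countable_lists[of "UNIV :: 's set"] by (rule countable_subset[rotated]) (auto simp: lists_UNIV)
  ultimately have "AE \<omega> in path_measure M. \<forall>u\<in>{u. u \<noteq> [] \<and> lpath ?E u}.
      \<forall>n. \<exists>i\<ge>n. \<omega> i \<notin> R u \<or> subsequence \<omega> i (i + length u) = u"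
    by (subst AE_ball_countable) auto
  with AE_path[of M] show ?thesis
  proof eventually_elim
    case (elim \<omega>)
    have "\<exists>\<^sub>\<infinity>n. subsequence \<omega> n (n + length u) = u"
      if u: "u \<noteq> []" "lpath ?E u" "hd u \<in> limit \<omega>" for u
    proof -
      have "\<omega> i \<in> R u" for i
      proof -
        obtain m where m: "m > i" "\<omega> m = hd u"
          using u(3) by (auto simp: limit_def INFM_nat)
        have "subsequence \<omega> i (Suc m) = \<omega> i # subsequence \<omega> (Suc i) (Suc m)"
          using m(1) by (simp add: subsequence_def upt_conv_Cons del: upt_Suc)
        moreover have "lpath ?E (subsequence \<omega> i (Suc m))"
          using elim by (intro lpath_subsequence) simp
        moreover have "last (subsequence \<omega> i (Suc m)) = hd u"
          using m by simp
        ultimately show ?thesis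
          unfolding R_def by (metis (mono_tags, lifting) mem_Collect_eq)
      qed
      then have "\<exists>i\<ge>n. subsequence \<omega> i (i + length u) = u" for n
        using elim u by blast
      then show ?thesis
        by (simp add: INFM_nat_le)
    qed
    then show ?case
      using elim by (simp add: fair_def)
  qed
qed

section \<open>From probability one to all fair paths\<close>

lemma fair_exists_pmf:
  fixes K :: "'s :: finite \<Rightarrow> 's pmf"
  shows "\<exists>w. fair (\<lambda>s. set_pmf (K s)) w \<and> w 0 = s"
proof (rule ccontr)
  \<comment> \<open>In the chain started at \<open>s\<close> almost every path is fair, so at least
    one is.\<close>
  let ?M = "\<lparr>transition = K, initial = s, label = (\<lambda>_. {})\<rparr> :: ('s, unit) markov_chain"
  interpret prob_space "path_measure ?M"
    by (rule prob_space_path_measure)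
  assume none: "\<not> ?thesis"
  have "AE \<omega> in path_measure ?M. False"
    using AE_fair[of ?M] by eventually_elim (use none in auto)
  then show False
    by simp
qed

text \<open>A fair path violating the formula has a finite prefix after which all fair paths violate
  it. The cylinder of this prefix has positive probability, so the formula cannot hold almost
  surely.\<close>

lemma V_eq1_iff_fair:
  fixes M :: "('s :: finite, 'a) markov_chain"
  shows "v \<in> V_eq1 M \<phi> \<longleftrightarrow>
    (\<forall>w. fair (\<lambda>s. set_pmf (transition M s)) w \<longrightarrow> w 0 = initial M \<longrightarrow> holds (label M) v \<phi> w)"
proof -
  let ?E = "\<lambda>s. set_pmf (transition M s)"
  interpret prob_space "path_measure M"
    by (rule prob_space_path_measure)
  have AE: "v \<in> V_eq1 M \<phi> \<longleftrightarrow> (AE \<omega> in path_measure M. holds (label M) v \<phi> \<omega>)"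
    using prob_eq_1[OF models_event_sets[of M v \<phi>]]
    by (simp add: V_eq1_def models_event_def holds_def)
  show ?thesis
  proof
    assume "v \<in> V_eq1 M \<phi>"
    then have sat: "AE \<omega> in path_measure M. holds (label M) v \<phi> \<omega>"
      using AE by simp
    show "\<forall>w. fair ?E w \<longrightarrow> w 0 = initial M \<longrightarrow> holds (label M) v \<phi> w"
    proof (intro allI impI)
      fix w
      assume w: "fair ?E w" "w 0 = initial M"
      obtain n where n: "\<And>w'. fair ?E w' \<Longrightarrow> (\<And>i. i < n \<Longrightarrow> w' i = w i) \<Longrightarrow>
          holds (label M) v \<phi> w' = holds (label M) v \<phi> w"
        using detE[OF det_holds w(1)] by metis
      \<comment> \<open>One letter more than \<open>n\<close> makes the prefix nonempty, as
        \<open>measure_cyl\<close> requires.\<close>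
      let ?u = "prefix (Suc n) w"
      have "hd ?u = initial M"
        using w(2) by (simp add: hd_conv_nth del: subseq_to_Suc)
      moreover have "0 < wt (transition M) ?u"
        unfolding wt_pos_iff by (rule lpath_subsequence) (rule fair_edge[OF w(1)])
      ultimately have "prob (cyl ?u) > 0"
        using measure_cyl[of ?u M] by (simp del: subseq_to_Suc)
      then have "\<not> (AE \<omega> in path_measure M. \<omega> \<notin> cyl ?u)"
        using prob_eq_0[OF cyl_sets, of ?u] by (simp del: subseq_to_Suc)
      moreover have "AE \<omega> in path_measure M. \<omega> \<notin> cyl ?u"
        if none: "\<nexists>\<omega>. holds (label M) v \<phi> \<omega> \<and> fair ?E \<omega> \<and> \<omega> \<in> cyl ?u"
        using sat AE_fair[of M] by eventually_elim (use none in blast)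
      ultimately obtain \<omega> where \<omega>: "holds (label M) v \<phi> \<omega>" "fair ?E \<omega>" "\<omega> \<in> cyl ?u"
        by blast
      have "\<omega> i = w i" if "i < n" for i
        using \<omega>(3) that by (simp add: cyl_eq del: subseq_to_Suc)
      then show "holds (label M) v \<phi> w"
        using n[OF \<omega>(2)] \<omega>(1) by blast
    qed
  next
    assume all: "\<forall>w. fair ?E w \<longrightarrow> w 0 = initial M \<longrightarrow> holds (label M) v \<phi> w"
    show "v \<in> V_eq1 M \<phi>"
      unfolding AE using AE_fair[of M] by eventually_elim (use all in blast)
  qed
qed

section \<open>The explicit bound\<close>

lemma len_neq_0 [simp]: "len \<phi> \<noteq> 0"
  by (cases \<phi>) auto

lemma finite_set2_pltl: "finite (set2_pltl \<phi>)"
  by (induction \<phi>) auto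

theorem theorem5:
  fixes M :: "('s :: finite, 'a) markov_chain" and \<phi> :: "('a, 'x) pltl"
  shows "V_eq1 M \<phi> \<noteq> {} \<longleftrightarrow> (\<lambda>x. CARD('s) * len \<phi> * 2 ^ len \<phi>) \<in> V_eq1 M \<phi>"
proof
  let ?E = "\<lambda>s. set_pmf (transition M s)"
  let ?N = "CARD('s) * len \<phi> * 2 ^ len \<phi>"
  assume "V_eq1 M \<phi> \<noteq> {}"
  then obtain v where "v \<in> V_eq1 M \<phi>"
    by blast
  then have v: "holds (label M) v \<phi> w" if "fair ?E w" "w 0 = initial M" for w
    using that by (simp add: V_eq1_iff_fair)
  \<comment> \<open>A single number above both the claimed bound and all values of \<open>v\<close>
    on the finitely many variables of the formula. By monotonicity it again gives probability
    one.\<close>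
  define K where "K = Max (insert ?N (v ` set2_pltl \<phi>))"
  have "?N \<le> K" and "x \<in> set2_pltl \<phi> \<Longrightarrow> v x \<le> K" for x
    by (simp_all add: K_def finite_set2_pltl)
  then have K: "holds (label M) (\<lambda>_. K) \<phi> w" if "fair ?E w" "w 0 = initial M" for w
    using v[OF that] sat_mono[of _ 0 v \<phi> "\<lambda>_. K"] by (simp add: holds_def)
  have "holds (label M) (\<lambda>_. ?N) \<phi> w" if w: "fair ?E w" "w 0 = initial M" for w
  \<comment> \<open>The factor \<open>len \<phi>\<close> supplies the factor 2 required by
    \<open>all_fair_holds_decrease\<close> only from length 2 on. A formula of length 1 is a
    proposition, whose truth does not depend on the valuation.\<close>
  proof (cases "len \<phi> = 1")
    case True
    then obtain a where "\<phi> = Prop a"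
      by (cases \<phi>) auto
    then show ?thesis
      using v[OF w] by (simp add: holds_simps)
  next
    case False
    then have "2 \<le> len \<phi>"
      using len_neq_0[of \<phi>] by linarith
    then have "2 * CARD('s) * 2 ^ len \<phi> \<le> ?N"
      by simp
    moreover have "(1 :: nat) * 2 * 2 ^ 2 \<le> ?N"
      using \<open>2 \<le> len \<phi>\<close> by (intro mult_le_mono power_increasing) (auto simp: Suc_le_eq)
    then have "8 \<le> ?N"
      by simp
    ultimately show ?thesis
      using all_fair_holds_decrease[OF fair_exists_pmf _ \<open>?N \<le> K\<close> _ K w] by blast
  qed
  then show "(\<lambda>x. ?N) \<in> V_eq1 M \<phi>"
    by (simp add: V_eq1_iff_fair)
qed blast

end
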